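(* Let $n=4$, let $f=f^*\in A_\Theta^\infty$, and equip $\mathcal X_\Theta$ with the conformally flat metric $g_{ij}=\langle\partial_i,\partial_j\rangle=e^{f}\delta_{ij}$, $i,j=1,\dots,4$. Let $R\in A_\Theta^\infty$ be the associated scalar curvature, and let $\sqrt{\det g}=e^{2f}$. Then $\tau(R\sqrt{\det g})\le 0$, and $\tau(R\sqrt{\det g})=0$ occurs only when the conformal coefficient $e^f$ is constant (i.e. $e^f\in\mathbb C\cdot 1$).
   Context: Let $\Theta=(\theta_{jk})$ be a real skew-symmetric $n\times n$ matrix. $A_\Theta$ is the universal unital $C^*$-algebra generated by unitaries $U_1,\dots,U_n$ with $U_jU_k=e^{2\pi i\theta_{jk}}U_kU_j$ (the noncommutative $n$-torus). For $k\in\mathbb Z^n$ put $U^k=U_1^{k_1}\cdots U_n^{k_n}$. $A_\Theta^\infty=\{\sum_{k\in\mathbb Z^n}a_kU^k:\ (a_k)\text{ rapidly decreasing}\}$ is the dense $*$-subalgebra of smooth elements, and $\tau(\sum a_kU^k)=a_0$ is the canonical faithful trace. The canonical derivations $\partial_1,\dots,\partial_n$ of $A_\Theta^\infty$ are determined by $\partial_j(U_k)=\delta_{jk}U_k$; thus $(\partial_j a)^*=-\partial_j(a^* )$. $\mathcal X_\Theta$ is the free left $A_\Theta^\infty$-module with basis also denoted $\partial_1,\dots,\partial_n$. A metric is a sesquilinear form $\langle\cdot,\cdot\rangle:\mathcal X_\Theta\times\mathcal X_\Theta\to A_\Theta^\infty$ with $\langle aX,Y\rangle=a\langle X,Y\rangle$,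 $\langle X,Y\rangle=\langle Y,X\rangle^*$, $\langle X,X\rangle\ge0$ with equality only for $X=0$, and $\langle\partial_i,\partial_j\rangle=\langle\partial_j,\partial_i\rangle$. Write $g_{ij}=\langle\partial_i,\partial_j\rangle$ and let $(g^{ij})$ be the inverse matrix of $(g_{ij})$. The associated (Levi-Civita) connection consists of the $\mathbb C$-linear operators $\nabla_i=\nabla_{\partial_i}$ on $\mathcal X_\Theta$ satisfying $\nabla_i(aX)=\partial_i(a)X+a\nabla_iX$ and $$\langle\nabla_i\partial_j,\partial_k\rangle=\tfrac12\{\partial_i g_{jk}+\partial_j g_{ik}-\partial_k g_{ij}\}.$$ The curvature is $R(\partial_i,\partial_j)=\nabla_j\nabla_i-\nabla_i\nabla_j$, with $R_{ijkl}=\langle R(\partial_i,\partial_j)\partial_k,\partial_l\rangle$, and the scalar curvature is $R=\sum_{i,j,k,l}g^{ij}g^{kl}R_{ikjl}$, which for a diagonal metric is $\sum_{i,k}g^{ii}g^{kk}R_{ikik}$. *)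

theory Defs
  imports "HOL-Analysis.Analysis"
begin

text \<open>Unital C*-algebras, with the complex scalar multiplication extending the library's real one.\<close>

class cstar_algebra = real_normed_algebra_1 + banach +
  fixes scaleC :: "complex \<Rightarrow> 'a \<Rightarrow> 'a"  (infixr "*\<^sub>C" 75)
    and star :: "'a \<Rightarrow> 'a"
  assumes scaleC_add_right: "c *\<^sub>C (x + y) = c *\<^sub>C x + c *\<^sub>C y"
    and scaleC_add_left: "(c + d) *\<^sub>C x = c *\<^sub>C x + d *\<^sub>C x"
    and scaleC_scaleC: "c *\<^sub>C d *\<^sub>C x = (c * d) *\<^sub>C x"
    and scaleC_of_real: "complex_of_real r *\<^sub>C x = r *\<^sub>R x"
    and scaleC_mult_left: "(c *\<^sub>C x) * y = c *\<^sub>C (x * y)"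
    and scaleC_mult_right: "x * (c *\<^sub>C y) = c *\<^sub>C (x * y)"
    and norm_scaleC: "norm (c *\<^sub>C x) = cmod c * norm x"
    and star_add: "star (x + y) = star x + star y"
    and star_scaleC: "star (c *\<^sub>C x) = cnj c *\<^sub>C star x"
    and star_mult: "star (x * y) = star y * star x"
    and star_star: "star (star x) = x"
    and cstar_identity: "norm (star x * x) = (norm x)\<^sup>2"

definition cstar_nonneg :: "'a::cstar_algebra \<Rightarrow> bool" where
  "cstar_nonneg a \<longleftrightarrow> (\<exists>b. a = star b * b)"


section \<open>The noncommutative torus\<close>

text \<open>The operations are explicit in the next two definitions because the universal property
  below speaks about arbitrary target C*-algebras, not only about the ambient one.\<close>

definition torus_relations ::
  "('b \<Rightarrow> 'b \<Rightarrow> 'b) \<Rightarrow> 'b \<Rightarrow> (complex \<Rightarrow> 'b \<Rightarrow> 'b) \<Rightarrow> ('b \<Rightarrow> 'b)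
    \<Rightarrow> real^'n^'n \<Rightarrow> ('n::finite \<Rightarrow> 'b) \<Rightarrow> bool" where
  "torus_relations tms e scl st \<Theta> V \<longleftrightarrow>
     (\<forall>j. tms (st (V j)) (V j) = e \<and> tms (V j) (st (V j)) = e) \<and>
     (\<forall>j k. tms (V j) (V k)
        = scl (exp (2 * complex_of_real pi * \<i> * complex_of_real (\<Theta> $ j $ k))) (tms (V k) (V j)))"

definition unital_star_hom ::
  "('b \<Rightarrow> 'b \<Rightarrow> 'b) \<Rightarrow> ('b \<Rightarrow> 'b \<Rightarrow> 'b) \<Rightarrow> 'b \<Rightarrow> (complex \<Rightarrow> 'b \<Rightarrow> 'b) \<Rightarrow> ('b \<Rightarrow> 'b)
    \<Rightarrow> ('a::cstar_algebra \<Rightarrow> 'b) \<Rightarrow> bool" where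
  "unital_star_hom pls tms e scl st \<phi> \<longleftrightarrow>
     (\<forall>x y. \<phi> (x + y) = pls (\<phi> x) (\<phi> y)) \<and>
     (\<forall>x y. \<phi> (x * y) = tms (\<phi> x) (\<phi> y)) \<and>
     \<phi> 1 = e \<and>
     (\<forall>c x. \<phi> (c *\<^sub>C x) = scl c (\<phi> x)) \<and>
     (\<forall>x. \<phi> (star x) = st (\<phi> x))"

definition cstar_generated_by :: "('n::finite \<Rightarrow> 'a::cstar_algebra) \<Rightarrow> bool" where
  "cstar_generated_by U \<longleftrightarrow>
     (\<forall>S. closed S \<and> range U \<subseteq> S \<and> 1 \<in> S \<and>
        (\<forall>x\<in>S. \<forall>y\<in>S. x + y \<in> S \<and> x * y \<in> S) \<and>
        (\<forall>c. \<forall>x\<in>S. c *\<^sub>C x \<in> S) \<and> (\<forall>x\<in>S. star x \<in> S)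
        \<longrightarrow> S = UNIV)"

text \<open>The type \<open>'a\<close> with generators \<open>U\<close> is the universal unital C*-algebra of the relations
  attached to \<open>\<Theta>\<close>.  The targets range over all C*-algebra structures \<^emph>\<open>on the same type\<close>; this is
  no restriction.  A finitely generated unital C*-algebra is separable, so if it is nonzero its
  underlying set has the cardinality of the continuum, as has \<open>'a\<close>; hence the subalgebra of any
  nonzero target generated by the images can be transported to \<open>'a\<close>.  (Into the zero algebra, which
  is excluded by the class axiom \<open>0 \<noteq> 1\<close>, there is always exactly one map.)  Uniqueness of
  \<open>\<phi>\<close> is a consequence of generation, since *-homomorphisms are continuous.\<close>

definition noncommutative_torus :: "real^'n^'n \<Rightarrow> ('n::finite \<Rightarrow> 'a::cstar_algebra) \<Rightarrow> bool" where
  "noncommutative_torus \<Theta> U \<longleftrightarrow>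
     torus_relations (*) 1 (*\<^sub>C) star \<Theta> U \<and>
     cstar_generated_by U \<and>
     (\<forall>dst unif opn mns nrm pls z umns sclR sg tms e scl st (V :: 'n \<Rightarrow> 'a).
        class.cstar_algebra dst unif opn mns nrm pls z umns sclR sg tms e scl st \<and>
        torus_relations tms e scl st \<Theta> V \<longrightarrow>
        (\<exists>\<phi> :: 'a \<Rightarrow> 'a. unital_star_hom pls tms e scl st \<phi> \<and> (\<forall>j. \<phi> (U j) = V j)))"

definition unitary_powi :: "'a::cstar_algebra \<Rightarrow> int \<Rightarrow> 'a" where
  "unitary_powi u m = (if m \<ge> 0 then u ^ nat m else star u ^ nat (- m))"

text \<open>\<open>U\<^sup>k\<close> is the product of the \<open>U\<^sub>j\<close> to the power \<open>k\<^sub>j\<close>, in increasing order of the indices.\<close>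

definition torus_monom :: "('n::{finite,linorder} \<Rightarrow> 'a::cstar_algebra) \<Rightarrow> int^'n::{finite,linorder} \<Rightarrow> 'a" where
  "torus_monom U k =
     prod_list (map (\<lambda>j. unitary_powi (U j) (k $ j)) (sorted_list_of_set UNIV))"

definition rapidly_decreasing :: "(int^'n::finite \<Rightarrow> complex) \<Rightarrow> bool" where
  "rapidly_decreasing c \<longleftrightarrow>
     (\<forall>p::nat. \<exists>C::real. \<forall>k. (1 + (\<Sum>j\<in>UNIV. \<bar>real_of_int (k $ j)\<bar>)) ^ p * cmod (c k) \<le> C)"

definition has_torus_expansion ::
  "('n::{finite,linorder} \<Rightarrow> 'a::cstar_algebra) \<Rightarrow> 'a \<Rightarrow> (int^'n::{finite,linorder} \<Rightarrow> complex) \<Rightarrow> bool" where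
  "has_torus_expansion U a c \<longleftrightarrow>
     rapidly_decreasing c \<and> ((\<lambda>k. c k *\<^sub>C torus_monom U k) has_sum a) UNIV"

definition smooth_elements :: "('n::{finite,linorder} \<Rightarrow> 'a::cstar_algebra) \<Rightarrow> 'a set" where
  "smooth_elements U = {a. \<exists>c. has_torus_expansion U a c}"

text \<open>On the noncommutative torus the coefficients of a smooth element are unique; on elements that
  are not smooth the following three functions carry no meaning.\<close>

definition torus_coeff ::
  "('n::{finite,linorder} \<Rightarrow> 'a::cstar_algebra) \<Rightarrow> 'a \<Rightarrow> int^'n::{finite,linorder} \<Rightarrow> complex" where
  "torus_coeff U a = (THE c. has_torus_expansion U a c)"

definition torus_trace :: "('n::{finite,linorder} \<Rightarrow> 'a::cstar_algebra) \<Rightarrow> 'a \<Rightarrow> complex" where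
  "torus_trace U a = torus_coeff U a 0"

text \<open>The continuous derivation of the smooth algebra with
  \<open>\<partial>\<^sub>j U\<^sub>k = \<delta>\<^sub>j\<^sub>k U\<^sub>k\<close> (no factor \<open>2 \<pi> \<i>\<close>), hence \<open>\<partial>\<^sub>j U\<^sup>k = k\<^sub>j U\<^sup>k\<close>.\<close>

definition torus_deriv ::
  "('n::{finite,linorder} \<Rightarrow> 'a::cstar_algebra) \<Rightarrow> 'n \<Rightarrow> 'a \<Rightarrow> 'a" where
  "torus_deriv U j a =
     (\<Sum>\<^sub>\<infinity>k\<in>UNIV. (of_int (k $ j) * torus_coeff U a k) *\<^sub>C torus_monom U k)"


section \<open>Metrics, Levi-Civita connections and curvature\<close>

text \<open>The free left module over the smooth algebra with basis \<open>\<partial>\<^sub>1, \<dots>, \<partial>\<^sub>n\<close>: vectors of smooth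
  elements, with left scalar multiplication \<open>*s\<close>; the basis vector \<open>\<partial>\<^sub>j\<close> is \<open>axis j 1\<close>.\<close>

definition torus_fields :: "('n::{finite,linorder} \<Rightarrow> 'a::cstar_algebra) \<Rightarrow> ('a^'n::{finite,linorder}) set" where
  "torus_fields U = {X. \<forall>j. X $ j \<in> smooth_elements U}"

abbreviation basis_field :: "'n::finite \<Rightarrow> 'a::cstar_algebra^'n" where
  "basis_field j \<equiv> axis j 1"

text \<open>Conjugate linearity in the second argument follows from the Hermitian symmetry.\<close>

definition torus_metric ::
  "('n::{finite,linorder} \<Rightarrow> 'a::cstar_algebra) \<Rightarrow> ('a^'n::{finite,linorder} \<Rightarrow> 'a^'n::{finite,linorder} \<Rightarrow> 'a) \<Rightarrow> bool" where
  "torus_metric U G \<longleftrightarrow>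
     (\<forall>X\<in>torus_fields U. \<forall>Y\<in>torus_fields U. G X Y \<in> smooth_elements U) \<and>
     (\<forall>X\<in>torus_fields U. \<forall>Y\<in>torus_fields U. \<forall>Z\<in>torus_fields U. G (X + Y) Z = G X Z + G Y Z) \<and>
     (\<forall>a\<in>smooth_elements U. \<forall>X\<in>torus_fields U. \<forall>Y\<in>torus_fields U. G (a *s X) Y = a * G X Y) \<and>
     (\<forall>X\<in>torus_fields U. \<forall>Y\<in>torus_fields U. G X Y = star (G Y X)) \<and>
     (\<forall>X\<in>torus_fields U. cstar_nonneg (G X X) \<and> (G X X = 0 \<longrightarrow> X = 0)) \<and>
     (\<forall>i j. G (basis_field i) (basis_field j) = G (basis_field j) (basis_field i))"

definition gram_matrix :: "('a::cstar_algebra^'n \<Rightarrow> 'a^'n \<Rightarrow> 'a) \<Rightarrow> 'a^'n^'n::finite" where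
  "gram_matrix G = (\<chi> i j. G (basis_field i) (basis_field j))"

text \<open>\<open>D i\<close> is the operator \<open>\<nabla>\<^sub>i\<close>.\<close>

definition levi_civita ::
  "('n::{finite,linorder} \<Rightarrow> 'a::cstar_algebra) \<Rightarrow> ('a^'n::{finite,linorder} \<Rightarrow> 'a^'n::{finite,linorder} \<Rightarrow> 'a)
    \<Rightarrow> ('n \<Rightarrow> 'a^'n::{finite,linorder} \<Rightarrow> 'a^'n::{finite,linorder}) \<Rightarrow> bool" where
  "levi_civita U G D \<longleftrightarrow>
     (\<forall>i. \<forall>X\<in>torus_fields U. D i X \<in> torus_fields U) \<and>
     (\<forall>i. \<forall>X\<in>torus_fields U. \<forall>Y\<in>torus_fields U. D i (X + Y) = D i X + D i Y) \<and>
     (\<forall>i c. \<forall>X\<in>torus_fields U. D i ((c *\<^sub>C 1) *s X) = (c *\<^sub>C 1) *s D i X) \<and>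
     (\<forall>i. \<forall>a\<in>smooth_elements U. \<forall>X\<in>torus_fields U.
        D i (a *s X) = torus_deriv U i a *s X + a *s D i X) \<and>
     (\<forall>i j k. G (D i (basis_field j)) (basis_field k) =
        (1/2) *\<^sub>R (torus_deriv U i (gram_matrix G $ j $ k) + torus_deriv U j (gram_matrix G $ i $ k)
                 - torus_deriv U k (gram_matrix G $ i $ j)))"

definition curvature_op ::
  "('n \<Rightarrow> 'a::cstar_algebra^'n \<Rightarrow> 'a^'n::finite) \<Rightarrow> 'n \<Rightarrow> 'n \<Rightarrow> 'a^'n \<Rightarrow> 'a^'n" where
  "curvature_op D i j X = D j (D i X) - D i (D j X)"

definition curvature_coeff ::
  "('a::cstar_algebra^'n \<Rightarrow> 'a^'n \<Rightarrow> 'a) \<Rightarrow> ('n \<Rightarrow> 'a^'n \<Rightarrow> 'a^'n::finite)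
    \<Rightarrow> 'n \<Rightarrow> 'n \<Rightarrow> 'n \<Rightarrow> 'n \<Rightarrow> 'a" where
  "curvature_coeff G D i j k l = G (curvature_op D i j (basis_field k)) (basis_field l)"

definition scalar_curvature ::
  "('a::cstar_algebra^'n \<Rightarrow> 'a^'n \<Rightarrow> 'a) \<Rightarrow> ('n \<Rightarrow> 'a^'n \<Rightarrow> 'a^'n::finite) \<Rightarrow> 'a" where
  "scalar_curvature G D =
     (\<Sum>i\<in>UNIV. \<Sum>j\<in>UNIV. \<Sum>k\<in>UNIV. \<Sum>l\<in>UNIV.
        matrix_inv (gram_matrix G) $ i $ j * matrix_inv (gram_matrix G) $ k $ l
          * curvature_coeff G D i k j l)"

end

theory Submission
  imports Defs
begin

text \<open>Let \<open>h = exp f\<close> and \<open>K\<^sub>i = (\<partial>\<^sub>i h) h\<inverse>\<close>.  The Christoffel symbols of the conformally flat metric are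
  linear in the \<open>K\<^sub>i\<close>, and contracting the curvature in dimension \<open>n\<close> gives
  \<open>R = - (n - 1) h\<inverse> h\<inverse> (\<Sum>\<^sub>i \<partial>\<^sub>i K\<^sub>i + (n - 2)/4 K\<^sub>i\<^sup>2) h\<close>, where the order of the factors matters because
  \<open>h\<close> need not commute with its derivatives.  For \<open>n = 4\<close> the weight \<open>exp (2 f) = h\<^sup>2\<close> and the trace
  property cancel all powers of \<open>h\<close> but one.  Since the trace of a derivative vanishes, the Leibniz
  rule turns the trace of \<open>(\<partial>\<^sub>i K\<^sub>i) h\<close> into minus that of \<open>K\<^sub>i (\<partial>\<^sub>i h) = K\<^sub>i\<^sup>2 h\<close>.  Finally \<open>\<partial>\<^sub>i h\<close> is
  anti-selfadjoint, so \<open>K\<^sub>i\<^sup>2 h = (\<partial>\<^sub>i h) h\<inverse> (\<partial>\<^sub>i h) = - x\<^sub>i\<^sup>* x\<^sub>i\<close> with \<open>x\<^sub>i = exp (- f/2) \<partial>\<^sub>i h\<close>.  Altogether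
  the total scalar curvature is \<open>- 3/2\<close> times the sum of the traces of the \<open>x\<^sub>i\<^sup>* x\<^sub>i\<close>
  (\<open>total_scalar_curvature_energy\<close>).  The trace is positive and faithful on smooth elements, so
  the value is at most \<open>0\<close>, and it is \<open>0\<close> only if every \<open>\<partial>\<^sub>i h\<close> vanishes, that is, if \<open>h\<close> is a scalar.

  This argument needs three facts about the smooth algebra.  The trace and the derivations are
  defined through the coefficients of an expansion, so these have to be unique: the gauge
  automorphisms \<open>U\<^sub>j \<mapsto> z\<^sub>j U\<^sub>j\<close>, which come from the universal property, can be averaged so as to
  remove any finite set of monomials without increasing the norm, and therefore each coefficient
  is bounded by the norm of the element (\<open>coeff_bound\<close>).  The averaging works because unital
  *-homomorphisms are contractive (\<open>unital_star_hom_contractive\<close>).  Next, the smooth elements are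
  closed under products and under \<open>exp\<close>, because the weighted \<open>\<ell>\<^sup>1\<close> norms of the coefficients are
  submultiplicative under twisted convolution (\<open>expansion_mult\<close>, \<open>smooth_exp\<close>).  Finally, the trace of a
  product is an explicit sum over the lattice, from which the trace property (\<open>trace_commute\<close>) and
  \<open>\<tau>(x\<^sup>* x) = \<Sum>\<^sub>k \<bar>c\<^sub>k\<bar>\<^sup>2\<close> (\<open>trace_star_mult_self\<close>) are read off.\<close>

section \<open>Elementary C*-algebra theory\<close>

lemma scaleC_zero_left [simp]: "0 *\<^sub>C x = (0::'a::cstar_algebra)"
  using scaleC_of_real[of 0 x] by simp

lemma scaleC_one [simp]: "1 *\<^sub>C x = (x::'a::cstar_algebra)"
  using scaleC_of_real[of 1 x] by simp

lemma scaleC_zero_right [simp]: "c *\<^sub>C (0::'a::cstar_algebra) = 0"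
  using scaleC_add_right[of c 0 "0::'a"] by simp

lemma scaleC_minus_right: "c *\<^sub>C (- x) = - (c *\<^sub>C (x::'a::cstar_algebra))"
  using scaleC_add_right[of c x "-x"] by (simp add: eq_neg_iff_add_eq_0 add.commute)

lemma scaleC_minus_left: "(- c) *\<^sub>C x = - (c *\<^sub>C (x::'a::cstar_algebra))"
  using scaleC_add_left[of c "-c" x] by (simp add: eq_neg_iff_add_eq_0 add.commute)

lemma scaleC_diff_right: "c *\<^sub>C (x - y) = c *\<^sub>C x - c *\<^sub>C (y::'a::cstar_algebra)"
  using scaleC_add_right[of c x "- y"] by (simp add: scaleC_minus_right)

lemma scaleC_scaleR: "c *\<^sub>C (r *\<^sub>R x) = r *\<^sub>R (c *\<^sub>C (x::'a::cstar_algebra))"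
  by (metis scaleC_of_real scaleC_scaleC mult.commute)

lemma bounded_linear_scaleC_right: "bounded_linear (\<lambda>x::'a::cstar_algebra. c *\<^sub>C x)"
  by (rule bounded_linear_intro[where K = "cmod c"])
     (simp_all add: scaleC_add_right scaleC_scaleR norm_scaleC mult.commute)

lemma bounded_linear_scaleC_left: "bounded_linear (\<lambda>c. c *\<^sub>C (x::'a::cstar_algebra))"
proof (rule bounded_linear_intro[where K = "norm x"])
  fix r :: real and c :: complex
  show "(r *\<^sub>R c) *\<^sub>C x = r *\<^sub>R (c *\<^sub>C x)"
    by (simp add: scaleR_conv_of_real scaleC_scaleC[symmetric] scaleC_of_real)
qed (simp_all add: scaleC_add_left norm_scaleC)

lemma star_zero [simp]: "star (0::'a::cstar_algebra) = 0"
  using star_add[of 0 "0::'a"] by simp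

lemma star_one [simp]: "star (1::'a::cstar_algebra) = 1"
  by (metis mult_1_left mult_1_right star_mult star_star)

lemma star_scaleR: "star (r *\<^sub>R x) = r *\<^sub>R star (x::'a::cstar_algebra)"
  by (metis scaleC_of_real star_scaleC complex_cnj_complex_of_real)

lemma norm_star [simp]: "norm (star x) = norm (x::'a::cstar_algebra)"
proof -
  have "norm y \<le> norm (star y)" for y :: 'a
  proof (cases "y = 0")
    case False
    have "norm y * norm y \<le> norm (star y) * norm y"
      using cstar_identity[of y] norm_mult_ineq[of "star y" y] by (simp add: power2_eq_square)
    with False show ?thesis by simp
  qed simp
  from this[of x] this[of "star x"] show ?thesis by (simp add: star_star)
qed

lemma bounded_linear_star: "bounded_linear (star :: 'a::cstar_algebra \<Rightarrow> 'a)"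
  by (rule bounded_linear_intro[where K = 1]) (simp_all add: star_add star_scaleR)

lemma star_minus: "star (- x) = - star (x::'a::cstar_algebra)"
  using bounded_linear.linear[OF bounded_linear_star] by (rule linear_neg)

lemma star_power: "star (x ^ n) = star (x::'a::cstar_algebra) ^ n"
  by (induction n) (simp_all add: star_mult power_commutes)

lemma star_exp: "star (exp x) = exp (star (x::'a::cstar_algebra))"
proof -
  have "star (exp x) = (\<Sum>n. star (x ^ n /\<^sub>R fact n))"
    unfolding exp_def
    by (rule bounded_linear.suminf[OF bounded_linear_star, symmetric, THEN sym])
       (rule summable_exp_generic)
  thus ?thesis by (simp add: exp_def star_scaleR star_power)
qed

lemma norm_isometry:
  fixes u :: "'a::cstar_algebra"
  assumes "star u * u = 1"
  shows "norm u = 1"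
  using cstar_identity[of u] assms by (simp add: power2_eq_1_iff) (smt (verit) norm_ge_zero)

text \<open>The binomial coefficients of \<open>1/2\<close> are the Taylor coefficients of the square root; that they are
  bounded makes the series converge on the open unit ball.\<close>

lemma abs_gbinomial_half_le_one: "\<bar>(1/2::real) gchoose n\<bar> \<le> 1"
proof (induction n)
  case (Suc n)
  have "(1/2::real) gchoose Suc n = (1/2 gchoose n) * ((1/2 - real n) / real (Suc n))"
    by (simp add: gbinomial_Suc_rec field_simps)
  moreover have "\<bar>(1/2 - real n) / real (Suc n)\<bar> \<le> 1" by (simp add: abs_if field_simps)
  ultimately show ?case using Suc.IH by (metis abs_mult mult_le_one abs_ge_zero)
qed simp

text \<open>The binomial series for \<open>(1 - q)\<^sup>1\<^sup>/\<^sup>2\<close> converges in norm.  Its square is computed by the Cauchy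
  product and the Vandermonde identity; as a real power series in \<open>q\<close>, it is selfadjoint and commutes
  with everything that commutes with \<open>q\<close>.\<close>

lemma square_root_of_one_minus:
  fixes q :: "'a::cstar_algebra"
  assumes "norm q < 1" "star q = q"
  obtains b where "star b = b" "b * b = 1 - q" "\<And>x. x * q = q * x \<Longrightarrow> x * b = b * x"
proof -
  define s where "s n = ((1/2::real) gchoose n) * (-1) ^ n" for n
  define t where "t n = s n *\<^sub>R q ^ n" for n
  have s1: "\<bar>s n\<bar> \<le> 1" for n
    using abs_gbinomial_half_le_one[of n] by (simp add: s_def abs_mult power_abs)
  have nsum: "summable (\<lambda>n. norm (t n))"
  proof (rule summable_comparison_test'[of "\<lambda>n. norm q ^ n" 0])
    show "norm (norm (t n)) \<le> norm q ^ n" for n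
      unfolding t_def using mult_mono[OF s1[of n] norm_power_ineq[of q n]] by simp
  qed (use assms in simp)
  hence sm: "summable t" by (rule summable_norm_cancel)
  define b where "b = suminf t"
  have "b * b = (\<Sum>n. \<Sum>i\<le>n. t i * t (n - i))"
    unfolding b_def by (rule Cauchy_product) (fact nsum)+
  also have "(\<lambda>n. \<Sum>i\<le>n. t i * t (n - i)) = (\<lambda>n. if n = 0 then 1 else if n = 1 then - q else 0)"
  proof
    fix n
    have "(\<Sum>i\<le>n. t i * t (n - i)) = (\<Sum>i\<le>n. (((1/2) gchoose i) * ((1/2) gchoose (n-i))) * (-1)^n) *\<^sub>R q ^ n"
      unfolding scaleR_sum_left
      by (rule sum.cong) (auto simp: t_def s_def mult_ac power_add[symmetric])
    also have "(\<Sum>i\<le>n. (((1/2) gchoose i) * ((1/2) gchoose (n-i))) * (-1)^n) = ((1::real) gchoose n) * (-1)^n"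
      using gbinomial_Vandermonde[of "1/2::real" "1/2" n]
      by (simp add: sum_distrib_right[symmetric] atMost_atLeast0)
    also have "(1::real) gchoose n = (if n \<le> 1 then 1 else 0)"
      using binomial_gbinomial[of 1 n, where ?'a = real] by (cases n rule: nat.exhaust; cases "n - 1") auto
    finally show "(\<Sum>i\<le>n. t i * t (n - i)) = (if n = 0 then 1 else if n = 1 then - q else 0)"
      by (cases "n = 0"; cases "n = 1"; simp)
  qed
  also have "(\<Sum>n. if n = 0 then 1 else if n = 1 then - q else 0) = 1 - q"
    by (subst suminf_finite[where N = "{0,1}"]) auto
  finally have "b * b = 1 - q" .
  moreover have "star b = b"
    unfolding b_def
    by (subst bounded_linear.suminf[OF bounded_linear_star sm]) (simp add: t_def[abs_def] star_scaleR star_power assms)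
  moreover have "x * b = b * x" if "x * q = q * x" for x
  proof -
    have "x * q ^ n = q ^ n * x" for n using that by (metis power_commuting_commutes)
    hence "x * t n = t n * x" for n by (simp add: t_def)
    thus ?thesis unfolding b_def by (simp add: suminf_mult[OF sm, symmetric] suminf_mult2[OF sm])
  qed
  ultimately show thesis using that by blast
qed

text \<open>A selfadjoint \<open>a\<close> with \<open>\<parallel>a\<parallel> < 1\<close> is the real part of the unitary \<open>a + i b\<close>, where
  \<open>b = (1 - a\<^sup>2)\<^sup>1\<^sup>/\<^sup>2\<close>.  The relations \<open>a\<^sup>2 + b\<^sup>2 = 1\<close> and \<open>a b = b a\<close> are algebraic, so they hold for the images
  too, which makes \<open>\<phi> a\<close> the average of the two unitaries \<open>\<phi> a \<plusminus> i \<phi> b\<close>.  Scaling and the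
  C*-identity extend the bound to all elements.  This route avoids spectral theory.\<close>

lemma unital_star_hom_contractive:
  fixes \<phi> :: "'a::cstar_algebra \<Rightarrow> 'a"
  assumes \<phi>: "unital_star_hom (+) (*) 1 (*\<^sub>C) star \<phi>"
  shows "norm (\<phi> a) \<le> norm a"
proof -
  have hom: "\<phi> (x + y) = \<phi> x + \<phi> y" "\<phi> (x * y) = \<phi> x * \<phi> y" "\<phi> 1 = 1"
    "\<phi> (c *\<^sub>C x) = c *\<^sub>C \<phi> x" "\<phi> (star x) = star (\<phi> x)" for x y c
    using \<phi> by (auto simp: unital_star_hom_def)
  \<comment> \<open>the selfadjoint part of the open unit ball; the general case follows by scaling\<close>
  have 1: "norm (\<phi> a) \<le> 1" if "star a = a" "norm a < 1" for a
  proof -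
    have "norm (a * a) < 1"
      using norm_mult_ineq[of a a] mult_strict_mono'[of "norm a" 1 "norm a" 1] that by simp
    moreover have "star (a * a) = a * a" by (simp add: star_mult that)
    ultimately obtain b where b: "star b = b" "b * b = 1 - a * a" "a * b = b * a"
      by (metis square_root_of_one_minus mult.assoc)
    define x y where "x = \<phi> a" and "y = \<phi> b"
    have sq: "x * x + y * y = 1"
      using b(2) hom by (metis x_def y_def add.commute diff_add_cancel)
    have comm: "x * y = y * x" using b(3) hom(2) by (metis x_def y_def)
    have sa: "star x = x" "star y = y" using b(1) that(1) hom(5) by (metis x_def y_def)+
    have "norm (x + c *\<^sub>C y) = 1" if c: "c = \<i> \<or> c = - \<i>" for c
    proof (rule norm_isometry)
      have "star (x + c *\<^sub>C y) * (x + c *\<^sub>C y) = (x - c *\<^sub>C y) * (x + c *\<^sub>C y)"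
        using c by (auto simp: star_add star_scaleC sa scaleC_minus_left)
      also have "\<dots> = x * x - (c * c) *\<^sub>C (y * y)"
        by (simp add: algebra_simps scaleC_mult_left scaleC_mult_right scaleC_scaleC scaleC_diff_right comm)
      also have "\<dots> = 1" using c sq by (auto simp: scaleC_minus_left)
      finally show "star (x + c *\<^sub>C y) * (x + c *\<^sub>C y) = 1" .
    qed
    from this[of \<i>] this[of "-\<i>"] have "norm ((x + \<i> *\<^sub>C y) + (x + (-\<i>) *\<^sub>C y)) \<le> 2"
      by (smt (verit) norm_triangle_ineq)
    also have "(x + \<i> *\<^sub>C y) + (x + (-\<i>) *\<^sub>C y) = 2 *\<^sub>R x"
      by (simp add: scaleC_minus_left scaleR_2)
    finally show ?thesis by (simp add: x_def)
  qed
  have 2: "norm (\<phi> a) \<le> norm a" if "star a = a" for a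
  proof (rule field_le_epsilon)
    fix e :: real assume "e > 0"
    define r where "r = norm a + e"
    have r: "r > 0" "norm a < r" using \<open>e > 0\<close> by (auto simp: r_def add_nonneg_pos)
    have "norm (\<phi> ((1/r) *\<^sub>R a)) \<le> 1"
      using r that by (intro 1) (simp_all add: star_scaleR)
    thus "norm (\<phi> a) \<le> norm a + e"
      using r hom(4)[of "complex_of_real (1/r)" a] by (simp add: scaleC_of_real r_def field_simps del: of_real_divide)
  qed
  have "(norm (\<phi> a))\<^sup>2 = norm (\<phi> (star a * a))"
    by (simp add: hom cstar_identity)
  also have "\<dots> \<le> norm (star a * a)" by (rule 2) (simp add: star_mult star_star)
  also have "\<dots> = (norm a)\<^sup>2" by (rule cstar_identity)
  finally show ?thesis by (rule power2_le_imp_le) simp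
qed

section \<open>Monomials and gauge automorphisms\<close>

lemma unitary_powi_add_one:
  fixes u :: "'a::cstar_algebra"
  assumes u: "star u * u = 1" "u * star u = 1"
  shows "unitary_powi u (m + 1) = unitary_powi u m * u"
proof (cases "m \<ge> 0")
  case True
  thus ?thesis by (simp add: unitary_powi_def nat_add_distrib power_commutes)
next
  case False
  define n where "n = nat (- m) - 1"
  have n: "nat (- m) = Suc n" "nat (- (m + 1)) = n" using False by (auto simp: n_def)
  have "unitary_powi u m * u = star u ^ n * (star u * u)"
    using False n by (simp add: unitary_powi_def power_Suc2 mult.assoc del: power_Suc)
  also have "\<dots> = star u ^ n" using u by simp
  also have "\<dots> = unitary_powi u (m + 1)"
    using False n by (auto simp: unitary_powi_def)
  finally show ?thesis by simp
qed

lemma unitary_powi_add: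
  fixes u :: "'a::cstar_algebra"
  assumes u: "star u * u = 1" "u * star u = 1"
  shows "unitary_powi u (m + n) = unitary_powi u m * unitary_powi u n"
proof (induction n rule: int_induct[where k = 0])
  case base
  show ?case by (simp add: unitary_powi_def)
next
  case (step1 i)
  thus ?case using unitary_powi_add_one[OF u, of "m + i"] unitary_powi_add_one[OF u, of i]
    by (simp add: add.assoc mult.assoc)
next
  case (step2 i)
  have "unitary_powi u (j - 1) = unitary_powi u j * star u" for j
    using unitary_powi_add_one[OF u, of "j - 1"] u(2) by (simp add: mult.assoc)
  from this[of i] this[of "m + i"] step2 show ?case
    by (simp add: add_diff_eq mult.assoc)
qed

text \<open>Reordering the generators in a product of monomials only creates scalars of modulus one, so the
  bookkeeping is done modulo such scalars.\<close>

definition phase_eq :: "'a::cstar_algebra \<Rightarrow> 'a \<Rightarrow> bool" (infix "\<simeq>" 50) where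
  "x \<simeq> y \<longleftrightarrow> (\<exists>t. cmod t = 1 \<and> x = t *\<^sub>C y)"

lemma phase_eq_refl [simp]: "x \<simeq> x"
  unfolding phase_eq_def by (rule exI[of _ 1]) simp

lemma phase_eq_trans [trans]: "x \<simeq> y \<Longrightarrow> y \<simeq> z \<Longrightarrow> x \<simeq> z"
  unfolding phase_eq_def by (metis scaleC_scaleC norm_mult mult_1)

lemma phase_eq_sym: assumes "x \<simeq> y" shows "y \<simeq> x"
proof -
  obtain t where t: "cmod t = 1" "x = t *\<^sub>C y" using assms by (auto simp: phase_eq_def)
  hence "y = cnj t *\<^sub>C x" by (simp add: scaleC_scaleC mult.commute[of "cnj t"] complex_norm_square[symmetric])
  thus ?thesis using t by (auto simp: phase_eq_def intro!: exI[of _ "cnj t"])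
qed

lemma phase_eq_mult: "x \<simeq> y \<Longrightarrow> x' \<simeq> y' \<Longrightarrow> x * x' \<simeq> y * y'"
  unfolding phase_eq_def
  by (metis scaleC_mult_left scaleC_mult_right scaleC_scaleC norm_mult mult_1)

lemma phase_commute_mult:
  assumes "x * y \<simeq> y * x" "x * z \<simeq> z * x"
  shows "x * (y * z) \<simeq> (y * z) * x"
proof -
  have "x * (y * z) \<simeq> y * x * z"
    using phase_eq_mult[OF assms(1) phase_eq_refl, of z] by (simp add: mult.assoc)
  also have "y * x * z \<simeq> y * (z * x)"
    using phase_eq_mult[OF phase_eq_refl assms(2), of y] by (simp add: mult.assoc)
  finally show ?thesis by (simp add: mult.assoc)
qed

lemma phase_commute_power: "x * y \<simeq> y * x \<Longrightarrow> x * y ^ n \<simeq> y ^ n * x"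
  by (induction n) (simp_all add: phase_commute_mult)

lemma phase_commute_star:
  fixes v :: "'a::cstar_algebra"
  assumes v: "star v * v = 1" "v * star v = 1" and c: "x * v \<simeq> v * x"
  shows "x * star v \<simeq> star v * x"
proof -
  have "star v * (x * v) * star v \<simeq> star v * (v * x) * star v"
    by (intro phase_eq_mult c phase_eq_refl)
  also have "star v * (v * x) * star v = x * star v"
    using v(1) by (simp add: mult.assoc[symmetric])
  finally have "star v * (x * v) * star v \<simeq> x * star v" .
  also have "star v * (x * v) * star v = star v * x"
    using v(2) by (simp add: mult.assoc)
  finally show ?thesis by (rule phase_eq_sym)
qed

lemma phase_commute_powi:
  fixes v :: "'a::cstar_algebra"
  assumes v: "star v * v = 1" "v * star v = 1" and c: "x * v \<simeq> v * x"
  shows "x * unitary_powi v m \<simeq> unitary_powi v m * x"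
  unfolding unitary_powi_def using phase_commute_star[OF v c] c by (auto intro: phase_commute_power)

lemma phase_commute_prod_list:
  assumes "\<And>y. y \<in> set ys \<Longrightarrow> x * y \<simeq> y * x"
  shows "x * prod_list ys \<simeq> prod_list ys * x"
  using assms by (induction ys) (simp_all add: phase_commute_mult)

text \<open>Moving every \<open>g j\<close> to the left past the later factors \<open>f i\<close> interleaves the two products.\<close>

lemma prod_list_mult_phase:
  assumes "\<And>i j. f i * g j \<simeq> g j * f i"
  shows "prod_list (map f js) * prod_list (map g js) \<simeq> prod_list (map (\<lambda>j. f j * g j) js)"
proof (induction js)
  case (Cons j js)
  let ?F = "prod_list (map f js)" and ?G = "prod_list (map g js)"
  have "g j * ?F \<simeq> ?F * g j"
    by (rule phase_commute_prod_list) (use assms phase_eq_sym in auto)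
  hence "?F * g j \<simeq> g j * ?F" by (rule phase_eq_sym)
  hence "f j * (?F * g j) * ?G \<simeq> f j * (g j * ?F) * ?G"
    by (rule phase_eq_mult[OF phase_eq_mult[OF phase_eq_refl] phase_eq_refl])
  also have "\<dots> = (f j * g j) * (?F * ?G)" by (simp add: mult.assoc)
  also have "\<dots> \<simeq> (f j * g j) * prod_list (map (\<lambda>j. f j * g j) js)"
    by (rule phase_eq_mult[OF phase_eq_refl Cons])
  finally show ?case by (simp add: mult.assoc)
qed simp

lemma prod_list_phases:
  "prod_list (map (\<lambda>j. cis (t j) *\<^sub>C (x j::'a::cstar_algebra)) js) =
     cis (sum_list (map t js)) *\<^sub>C prod_list (map x js)"
  by (induction js) (simp_all add: scaleC_mult_left scaleC_mult_right scaleC_scaleC cis_mult add.commute)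

lemma unitary_powi_phase:
  "unitary_powi (cis t *\<^sub>C u) m = cis (of_int m * t) *\<^sub>C unitary_powi (u::'a::cstar_algebra) m"
proof -
  have *: "(c *\<^sub>C x) ^ n = (c ^ n) *\<^sub>C x ^ n" for c n and x :: 'a
    by (induction n) (simp_all add: scaleC_mult_left scaleC_mult_right scaleC_scaleC mult.commute)
  have "cis s ^ nat p = cis (of_int p * s)" if "p \<ge> 0" for s p
    using that by (simp only: Complex.DeMoivre) simp
  from this[of m t] this[of "- m" "- t"] show ?thesis
    by (auto simp: unitary_powi_def * star_scaleC cis_cnj)
qed

locale nc_torus =
  fixes \<Theta> :: "real^'n::{finite,linorder}^'n::{finite,linorder}" and U :: "'n \<Rightarrow> 'a::cstar_algebra"
  assumes nc_torus: "noncommutative_torus \<Theta> U"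
begin

lemma U_unitary: "star (U j) * U j = 1" "U j * star (U j) = 1"
  using nc_torus unfolding noncommutative_torus_def torus_relations_def by blast+

lemma U_commute: "U j * U k = exp (2 * complex_of_real pi * \<i> * complex_of_real (\<Theta> $ j $ k)) *\<^sub>C (U k * U j)"
  using nc_torus unfolding noncommutative_torus_def torus_relations_def by blast+

lemma powi_phase_commute: "unitary_powi (U i) m * unitary_powi (U j) n \<simeq> unitary_powi (U j) n * unitary_powi (U i) m"
proof -
  have "U i * U j \<simeq> U j * U i"
    unfolding phase_eq_def using U_commute[of i j]
    by (intro exI[of _ "exp (2 * complex_of_real pi * \<i> * complex_of_real (\<Theta> $ i $ j))"])
       (simp add: norm_exp_eq_Re)
  hence "U i * unitary_powi (U j) n \<simeq> unitary_powi (U j) n * U i"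
    by (intro phase_commute_powi U_unitary)
  hence "unitary_powi (U j) n * U i \<simeq> U i * unitary_powi (U j) n" by (rule phase_eq_sym)
  hence "unitary_powi (U j) n * unitary_powi (U i) m \<simeq> unitary_powi (U i) m * unitary_powi (U j) n"
    by (intro phase_commute_powi U_unitary)
  thus ?thesis by (rule phase_eq_sym)
qed

lemma monom_mult_phase: "torus_monom U k * torus_monom U l \<simeq> torus_monom U (k + l)"
  unfolding torus_monom_def
  using prod_list_mult_phase[of "\<lambda>j. unitary_powi (U j) (k $ j)" "\<lambda>j. unitary_powi (U j) (l $ j)"]
  by (simp add: powi_phase_commute unitary_powi_add U_unitary)

lemma monom_zero [simp]: "torus_monom U 0 = 1"
proof -
  have "prod_list (map (\<lambda>j. 1::'a) js) = 1" for js :: "'n list" by (induction js) auto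
  thus ?thesis unfolding torus_monom_def by (simp add: unitary_powi_def)
qed

text \<open>The 2-cocycle of the twisted group algebra of the lattice, relative to the basis of ordered monomials.\<close>

definition twist :: "int^'n::{finite,linorder} \<Rightarrow> int^'n::{finite,linorder} \<Rightarrow> complex" where
  "twist k l = (SOME t. cmod t = 1 \<and> torus_monom U k * torus_monom U l = t *\<^sub>C torus_monom U (k + l))"

lemma norm_twist [simp]: "cmod (twist k l) = 1"
  and monom_mult: "torus_monom U k * torus_monom U l = twist k l *\<^sub>C torus_monom U (k + l)"
  using someI_ex[OF monom_mult_phase[of k l, unfolded phase_eq_def]] unfolding twist_def by blast+

lemma monom_unitary:
  "star (torus_monom U k) * torus_monom U k = 1" "torus_monom U k * star (torus_monom U k) = 1"
proof -
  have *: "star (prod_list xs) * prod_list xs = 1 \<and> prod_list xs * star (prod_list xs) = 1"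
    if "\<forall>x\<in>set xs. star x * x = 1 \<and> x * star x = 1" for xs :: "'a list"
    using that
  proof (induction xs)
    case (Cons x xs)
    have "star (prod_list (x # xs)) * prod_list (x # xs) = star (prod_list xs) * (star x * x) * prod_list xs"
      by (simp add: star_mult mult.assoc)
    moreover have "prod_list (x # xs) * star (prod_list (x # xs)) = x * (prod_list xs * star (prod_list xs)) * star x"
      by (simp add: star_mult mult.assoc)
    ultimately show ?case using Cons by simp
  qed simp
  have star_powi: "star (unitary_powi (U j) m) = unitary_powi (U j) (- m)" for j m
    by (auto simp: unitary_powi_def star_power star_star)
  have "unitary_powi (U j) m * unitary_powi (U j) (- m) = 1" for j m
    using unitary_powi_add[OF U_unitary, of j m "- m"] by (simp add: unitary_powi_def)
  hence powi_unitary: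
    "star (unitary_powi (U j) m) * unitary_powi (U j) m = 1"
    "unitary_powi (U j) m * star (unitary_powi (U j) m) = 1" for j m
    unfolding star_powi by (metis minus_minus)+
  show "star (torus_monom U k) * torus_monom U k = 1"
    unfolding torus_monom_def by (rule *[THEN conjunct1]) (auto simp: powi_unitary)
  show "torus_monom U k * star (torus_monom U k) = 1"
    unfolding torus_monom_def by (rule *[THEN conjunct2]) (auto simp: powi_unitary)
qed

lemma norm_monom [simp]: "norm (torus_monom U k) = 1"
  by (rule norm_isometry) (rule monom_unitary)

lemma star_monom: "star (torus_monom U k) = cnj (twist k (- k)) *\<^sub>C torus_monom U (- k)"
proof -
  have "star (torus_monom U k) * (torus_monom U k * torus_monom U (- k)) = twist k (-k) *\<^sub>C star (torus_monom U k)"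
    by (simp add: monom_mult scaleC_mult_right)
  moreover have "star (torus_monom U k) * (torus_monom U k * torus_monom U (- k)) = torus_monom U (- k)"
    by (simp add: mult.assoc[symmetric] monom_unitary)
  ultimately show ?thesis
    by (simp add: scaleC_scaleC mult.commute[of "cnj _"] complex_norm_square[symmetric])
qed

text \<open>Both sides are the scalar by which \<open>U\<^sup>-\<^sup>k\<close> differs from the inverse of \<open>U\<^sup>k\<close>, and left and right
  inverses agree.\<close>

lemma twist_uminus: "twist (- k) k = twist k (- k)"
proof -
  have "torus_monom U k * torus_monom U (- k) = twist k (-k) *\<^sub>C 1" by (simp add: monom_mult)
  hence "star (torus_monom U k) * (torus_monom U k * torus_monom U (- k)) * torus_monom U k
      = twist k (-k) *\<^sub>C 1"
    by (simp add: scaleC_mult_left scaleC_mult_right monom_unitary)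
  moreover have "star (torus_monom U k) * (torus_monom U k * torus_monom U (- k)) * torus_monom U k =
     torus_monom U (- k) * torus_monom U k"
    by (simp add: mult.assoc[symmetric] monom_unitary)
  ultimately have "twist (- k) k *\<^sub>C (1::'a) = twist k (-k) *\<^sub>C 1" by (simp add: monom_mult)
  hence "(twist (- k) k - twist k (-k)) *\<^sub>C (1::'a) = 0"
    using scaleC_add_left[of "twist (-k) k" "- twist k (-k)" "1::'a"] by (simp add: scaleC_minus_left)
  thus ?thesis using norm_scaleC[of "twist (- k) k - twist k (-k)" "1::'a"] by simp
qed

text \<open>Multiplying the generators by scalars of modulus one preserves the defining relations, so the
  universal property, applied with the algebra itself as target, provides the homomorphism.\<close>

lemma gauge_action:
  fixes t :: "'n \<Rightarrow> real"
  obtains \<phi> :: "'a \<Rightarrow> 'a" where "unital_star_hom (+) (*) 1 (*\<^sub>C) star \<phi>"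
    "\<And>k. \<phi> (torus_monom U k) = cis (\<Sum>j\<in>UNIV. of_int (k $ j) * t j) *\<^sub>C torus_monom U k"
proof -
  define V where "V j = cis (t j) *\<^sub>C U j" for j
  have cst: "class.cstar_algebra dist uniformity open minus norm plus (0::'a) uminus scaleR sgn times 1 scaleC star"
    by standard
  have "torus_relations (*) 1 (*\<^sub>C) star \<Theta> V"
    unfolding torus_relations_def
  proof (intro conjI allI)
    fix j k
    show "star (V j) * V j = 1" "V j * star (V j) = 1"
      by (simp_all add: V_def star_scaleC scaleC_mult_left scaleC_mult_right scaleC_scaleC U_unitary cis_cnj cis_mult)
    show "V j * V k = exp (2 * complex_of_real pi * \<i> * complex_of_real (\<Theta> $ j $ k)) *\<^sub>C (V k * V j)"
      by (simp add: V_def scaleC_mult_left scaleC_mult_right scaleC_scaleC U_commute[of j k] mult_ac)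
  qed
  with cst nc_torus obtain \<phi> :: "'a \<Rightarrow> 'a"
    where \<phi>: "unital_star_hom (+) (*) 1 (*\<^sub>C) star \<phi>" "\<And>j. \<phi> (U j) = V j"
    unfolding noncommutative_torus_def by blast
  have hom: "\<phi> (x * y) = \<phi> x * \<phi> y" "\<phi> 1 = 1" "\<phi> (star x) = star (\<phi> x)" for x y
    using \<phi>(1) by (auto simp: unital_star_hom_def)
  have pow: "\<phi> (x ^ n) = \<phi> x ^ n" for x n by (induction n) (simp_all add: hom)
  have powi: "\<phi> (unitary_powi x m) = unitary_powi (\<phi> x) m" for x m
    by (simp add: unitary_powi_def pow hom)
  have prod: "\<phi> (prod_list xs) = prod_list (map \<phi> xs)" for xs
    by (induction xs) (simp_all add: hom)
  have "\<phi> (torus_monom U k) = cis (\<Sum>j\<in>UNIV. of_int (k $ j) * t j) *\<^sub>C torus_monom U k" for k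
    unfolding torus_monom_def
    by (simp add: prod o_def powi \<phi>(2) V_def unitary_powi_phase prod_list_phases sum_list_distinct_conv_sum_set)
  with \<phi>(1) show thesis using that by blast
qed

end

section \<open>Rapidly decreasing coefficients\<close>

definition weight :: "int^'n::finite \<Rightarrow> real" where
  "weight k = 1 + (\<Sum>j\<in>UNIV. \<bar>real_of_int (k $ j)\<bar>)"

lemma weight_ge_1: "weight k \<ge> 1"
  by (simp add: weight_def sum_nonneg)

lemma weight_pos: "weight k > 0" and weight_nonneg: "weight k \<ge> 0"
  using weight_ge_1[of k] by linarith+

lemma weight_uminus: "weight (- k) = weight k"
  by (simp add: weight_def)

lemma weight_component: "\<bar>real_of_int (k $ j)\<bar> \<le> weight k"
  using member_le_sum[of j UNIV "\<lambda>j. \<bar>real_of_int (k $ j)\<bar>"] by (simp add: weight_def)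

lemma weight_add_le: "weight (k + l) \<le> weight k * weight l"
proof -
  let ?s = "\<lambda>k::int^'n. \<Sum>j\<in>UNIV. \<bar>real_of_int (k $ j)\<bar>"
  have "?s (k + l) \<le> ?s k + ?s l"
    unfolding sum.distrib[symmetric] by (rule sum_mono) simp
  moreover have "0 \<le> ?s k * ?s l" by (intro mult_nonneg_nonneg sum_nonneg) auto
  moreover have "weight k * weight l = 1 + ?s k + ?s l + ?s k * ?s l"
    by (simp add: weight_def algebra_simps)
  moreover have "weight (k + l) = 1 + ?s (k + l)" by (rule weight_def)
  ultimately show ?thesis by linarith
qed

text \<open>The power is chosen such that the weight is distributed over the coordinates: each of them receives
  the summable factor \<open>(1 + \<bar>k\<^sub>j\<bar>)\<^sup>-\<^sup>2\<close>.\<close>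

lemma summable_on_inverse_weight_power:
  "(\<lambda>k::int^'n::finite. 1 / weight k ^ (2 * CARD('n))) summable_on UNIV"
proof -
  define g where "g i = 1 / (1 + \<bar>real_of_int i\<bar>) ^ 2" for i
  have "summable (\<lambda>n. norm (1 / (1 + real n) ^ 2))"
    using summable_Suc_iff[of "\<lambda>n. inverse (real n ^ 2)"] inverse_power_summable[of 2, where ?'a = real]
    by (simp add: divide_inverse add.commute)
  hence nat: "(\<lambda>n. 1 / (1 + real n) ^ 2) summable_on UNIV" by (rule norm_summable_imp_summable_on)
  have "g summable_on range int" "g summable_on range (\<lambda>n. - int n)"
    using nat by (subst summable_on_reindex; simp add: inj_on_def g_def o_def)+
  moreover have "range (\<lambda>n. - int n) \<union> range int = UNIV"
    by (auto simp: image_iff) (metis int_cases2)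
  ultimately have "g summable_on UNIV"
    using summable_on_Un_disjoint[of g "range int" "range (\<lambda>n. - int n) - range int"]
      summable_on_subset_banach[of g "range (\<lambda>n. - int n)" "range (\<lambda>n. - int n) - range int"]
    by (simp add: Un_commute)
  moreover have "norm (g i) = g i" for i by (simp add: g_def)
  ultimately have "Infinite_Set_Sum.abs_summable_on g UNIV"
    by (simp add: abs_summable_equivalent[symmetric])
  hence "Infinite_Set_Sum.abs_summable_on (\<lambda>h. \<Prod>j\<in>(UNIV::'n set). g (h j)) (PiE UNIV (\<lambda>_. UNIV))"
    by (intro abs_summable_on_prod_PiE) auto
  hence "(\<lambda>h::'n \<Rightarrow> int. \<Prod>j\<in>UNIV. g (h j)) summable_on UNIV"
    by (simp add: abs_summable_equivalent[symmetric] g_def prod_nonneg PiE_UNIV_domain)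
  hence "(\<lambda>k::int^'n. \<Prod>j\<in>UNIV. g (k $ j)) summable_on UNIV"
    by (subst (asm) summable_on_reindex_bij_betw[of vec_nth, symmetric])
       (auto intro!: bij_betwI[where g = vec_lambda])
  thus ?thesis
  proof (rule summable_on_comparison_test)
    fix k :: "int^'n"
    have "1 / weight k ^ (2 * CARD('n)) = (\<Prod>j\<in>(UNIV::'n set). 1 / weight k ^ 2)"
      by (simp add: power_mult power_one_over)
    also have "\<dots> \<le> (\<Prod>j\<in>UNIV. g (k $ j))"
    proof (rule prod_mono, intro conjI)
      fix j
      have "1 + \<bar>real_of_int (k $ j)\<bar> \<le> weight k"
        using member_le_sum[of j UNIV "\<lambda>j. \<bar>real_of_int (k $ j)\<bar>"] by (simp add: weight_def)
      thus "1 / weight k ^ 2 \<le> g (k $ j)"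
        unfolding g_def by (intro divide_left_mono power_mono mult_pos_pos zero_less_power) (auto simp: weight_pos)
    qed simp
    finally show "1 / weight k ^ (2 * CARD('n)) \<le> (\<Prod>j\<in>UNIV. g (k $ j))" .
  qed (simp add: weight_nonneg)
qed

text \<open>Absolute summability against all weights is more convenient than boundedness, because it passes to
  convolutions.  The two agree since raising the power of the weight makes a bounded family summable.\<close>

lemma rapidly_decreasing_iff:
  fixes c :: "int^'n::finite \<Rightarrow> complex"
  shows "rapidly_decreasing c \<longleftrightarrow> (\<forall>p. (\<lambda>k. weight k ^ p * cmod (c k)) summable_on UNIV)"
proof
  assume c: "rapidly_decreasing c"
  show "\<forall>p. (\<lambda>k. weight k ^ p * cmod (c k)) summable_on UNIV"
  proof
    fix p
    let ?q = "2 * CARD('n)"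
    obtain C where C: "weight k ^ (p + ?q) * cmod (c k) \<le> C" for k
      using c unfolding rapidly_decreasing_def weight_def by metis
    have "(\<lambda>k::int^'n. C * (1 / weight k ^ ?q)) summable_on UNIV"
      by (intro summable_on_cmult_right summable_on_inverse_weight_power)
    thus "(\<lambda>k. weight k ^ p * cmod (c k)) summable_on UNIV"
    proof (rule summable_on_comparison_test)
      fix k
      show "weight k ^ p * cmod (c k) \<le> C * (1 / weight k ^ ?q)"
        using C[of k] weight_pos[of k] by (simp add: pos_le_divide_eq power_add mult_ac)
    qed (simp add: weight_nonneg)
  qed
next
  assume c: "\<forall>p. (\<lambda>k. weight k ^ p * cmod (c k)) summable_on UNIV"
  have "weight k ^ p * cmod (c k) \<le> (\<Sum>\<^sub>\<infinity>k. weight k ^ p * cmod (c k))" for k p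
    using finite_sum_le_infsum[of "\<lambda>k. weight k ^ p * cmod (c k)" UNIV "{k}"] c by (simp add: weight_nonneg)
  thus "rapidly_decreasing c"
    unfolding rapidly_decreasing_def weight_def[symmetric] by blast
qed

lemma rapidly_decreasing_abs_summable:
  "rapidly_decreasing c \<Longrightarrow> (\<lambda>k. cmod (c k)) summable_on UNIV"
  using rapidly_decreasing_iff[of c] by (metis (no_types, lifting) mult_1 power_0 summable_on_cong)

lemma rapidly_decreasing_bounded_factor:
  assumes c: "rapidly_decreasing c" and d: "\<And>k. cmod (d k) \<le> weight k ^ q * cmod (c k)"
  shows "rapidly_decreasing d"
  unfolding rapidly_decreasing_iff
proof
  fix p
  have "(\<lambda>k. weight k ^ (p + q) * cmod (c k)) summable_on UNIV"
    using c by (simp add: rapidly_decreasing_iff)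
  thus "(\<lambda>k. weight k ^ p * cmod (d k)) summable_on UNIV"
  proof (rule summable_on_comparison_test)
    show "weight k ^ p * cmod (d k) \<le> weight k ^ (p + q) * cmod (c k)" for k
      using mult_left_mono[OF d[of k], of "weight k ^ p"] by (simp add: power_add mult.assoc weight_nonneg)
  qed (simp add: weight_nonneg)
qed

lemma rapidly_decreasing_add:
  assumes "rapidly_decreasing c" "rapidly_decreasing d"
  shows "rapidly_decreasing (\<lambda>k. c k + d k)"
  unfolding rapidly_decreasing_iff
proof
  fix p
  have "(\<lambda>k. weight k ^ p * cmod (c k) + weight k ^ p * cmod (d k)) summable_on UNIV"
    using assms by (intro summable_on_add) (auto simp: rapidly_decreasing_iff)
  thus "(\<lambda>k. weight k ^ p * cmod (c k + d k)) summable_on UNIV"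
  proof (rule summable_on_comparison_test)
    show "weight k ^ p * cmod (c k + d k) \<le> weight k ^ p * cmod (c k) + weight k ^ p * cmod (d k)" for k
      using mult_left_mono[OF norm_triangle_ineq[of "c k" "d k"], of "weight k ^ p"]
      by (simp add: distrib_left weight_nonneg)
  qed (simp add: weight_nonneg)
qed

section \<open>Uniqueness of the coefficients\<close>

context nc_torus
begin

text \<open>Given \<open>k\<^sub>0 \<noteq> m\<close>, choose a gauge automorphism \<open>\<phi>\<close> that multiplies \<open>U\<^sup>k\<close> by \<open>z\<^sub>k\<close> with
  \<open>z\<^bsub>k\<^sub>0\<^esub> = - z\<^sub>m\<close>.  The map \<open>x \<mapsto> (x + z\<^sub>m\<inverse> \<phi> x)/2\<close> is contractive, kills the monomial with index \<open>k\<^sub>0\<close>, fixes the one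
  with index \<open>m\<close> and multiplies all others by scalars of modulus at most one.  Composing such maps
  removes any finite set of monomials.\<close>

lemma coeff_averaging:
  assumes hs: "((\<lambda>k. c k *\<^sub>C torus_monom U k) has_sum a) UNIV" and "finite F" "m \<notin> F"
  shows "\<exists>b d. norm b \<le> norm a \<and> ((\<lambda>k. d k *\<^sub>C torus_monom U k) has_sum b) UNIV \<and>
           d m = c m \<and> (\<forall>k. cmod (d k) \<le> cmod (c k)) \<and> (\<forall>k\<in>F. d k = 0)"
  using \<open>finite F\<close> \<open>m \<notin> F\<close>
proof (induction F)
  case empty
  show ?case by (intro exI[of _ a] exI[of _ c]) (simp add: hs)
next
  case (insert k0 F)
  then obtain b d where bd: "norm b \<le> norm a" "((\<lambda>k. d k *\<^sub>C torus_monom U k) has_sum b) UNIV"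
    "d m = c m" "\<And>k. cmod (d k) \<le> cmod (c k)" "\<And>k. k \<in> F \<Longrightarrow> d k = 0" by auto
  from insert.prems obtain j where j: "k0 $ j \<noteq> m $ j" by (metis vec_eq_iff insertI1)
  \<comment> \<open>this angle makes the gauge phases of \<open>k0\<close> and \<open>m\<close> differ by \<open>cis pi = -1\<close>\<close>
  define \<theta> where "\<theta> = pi / of_int (k0 $ j - m $ j)"
  obtain \<phi> where \<phi>: "unital_star_hom (+) (*) 1 (*\<^sub>C) star \<phi>"
    "\<And>k. \<phi> (torus_monom U k) = cis (\<Sum>i\<in>UNIV. of_int (k $ i) * (if i = j then \<theta> else 0)) *\<^sub>C torus_monom U k"
    using gauge_action[of "\<lambda>i. if i = j then \<theta> else 0"] by blast
  have \<phi>_monom: "\<phi> (torus_monom U k) = cis (of_int (k $ j) * \<theta>) *\<^sub>C torus_monom U k" for k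
    using \<phi>(2)[of k] by (simp add: if_distrib cong: if_cong)
  have hom: "\<phi> (x + y) = \<phi> x + \<phi> y" "\<phi> (z *\<^sub>C x) = z *\<^sub>C \<phi> x" for x y z
    using \<phi>(1) by (auto simp: unital_star_hom_def)
  have contr: "norm (\<phi> x) \<le> norm x" for x using unital_star_hom_contractive[OF \<phi>(1)] .
  have "bounded_linear \<phi>"
    by (rule bounded_linear_intro[where K = 1]) (simp_all add: hom contr flip: scaleC_of_real)
  hence bl: "bounded_linear (\<lambda>x. (1/2) *\<^sub>C (x + cis (- of_int (m $ j) * \<theta>) *\<^sub>C \<phi> x))"
    by (intro bounded_linear_compose[OF bounded_linear_scaleC_right] bounded_linear_add bounded_linear_ident)
  define b' where "b' = (1/2) *\<^sub>C (b + cis (- of_int (m $ j) * \<theta>) *\<^sub>C \<phi> b)"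
  define d' where "d' k = (1 + cis (of_int (k $ j - m $ j) * \<theta>)) / 2 * d k" for k
  have "(1/2) *\<^sub>C (d k *\<^sub>C torus_monom U k + cis (- of_int (m $ j) * \<theta>) *\<^sub>C \<phi> (d k *\<^sub>C torus_monom U k))
       = d' k *\<^sub>C torus_monom U k" for k
  proof -
    have "cis (- of_int (m $ j) * \<theta>) * (d k * cis (of_int (k $ j) * \<theta>)) = cis (of_int (k $ j - m $ j) * \<theta>) * d k"
      by (simp add: cis_mult mult.left_commute[of _ "d k"] mult.commute[of _ "d k"] algebra_simps del: of_int_diff)
         (simp add: algebra_simps)
    hence "cis (- of_int (m $ j) * \<theta>) *\<^sub>C \<phi> (d k *\<^sub>C torus_monom U k)
        = (cis (of_int (k $ j - m $ j) * \<theta>) * d k) *\<^sub>C torus_monom U k"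
      by (simp only: hom \<phi>_monom scaleC_scaleC)
    thus ?thesis
      by (simp only: scaleC_scaleC scaleC_add_left[symmetric] d'_def)
         (simp add: distrib_right del: of_int_diff)
  qed
  hence "((\<lambda>k. d' k *\<^sub>C torus_monom U k) has_sum b') UNIV"
    using has_sum_bounded_linear[OF bl bd(2)] by (simp add: b'_def)
  moreover have "norm b' \<le> norm a"
  proof -
    have "norm (b + cis (- of_int (m $ j) * \<theta>) *\<^sub>C \<phi> b) \<le> norm b + norm b"
      by (rule order_trans[OF norm_triangle_ineq]) (simp add: norm_scaleC contr)
    thus ?thesis using bd(1) by (simp add: b'_def norm_scaleC)
  qed
  moreover have "d' m = c m" using bd(3) by (simp add: d'_def)
  moreover have "cmod (d' k) \<le> cmod (c k)" for k
  proof -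
    have "cmod (1 + cis (of_int (k $ j - m $ j) * \<theta>)) \<le> 1 + 1"
      by (rule order_trans[OF norm_triangle_ineq]) simp
    hence "cmod ((1 + cis (of_int (k $ j - m $ j) * \<theta>)) / 2) \<le> 1" by (simp add: norm_divide)
    from mult_mono[OF this bd(4)[of k]] show ?thesis by (simp add: d'_def norm_mult)
  qed
  moreover have "d' k = 0" if "k \<in> insert k0 F" for k
  proof (cases "k = k0")
    case True
    have "of_int (k0 $ j - m $ j) * \<theta> = pi" using j by (simp add: \<theta>_def del: of_int_diff)
    thus ?thesis using True by (simp add: d'_def del: of_int_diff)
  qed (use that bd(5) in \<open>simp add: d'_def\<close>)
  ultimately show ?case by blast
qed

text \<open>After averaging, the element consists of the \<open>m\<close>-th term and a remainder that is controlled by an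
  arbitrarily small tail of the coefficients.\<close>

lemma coeff_bound:
  assumes "has_torus_expansion U a c"
  shows "cmod (c m) \<le> norm a"
proof (rule field_le_epsilon)
  fix e :: real assume "e > 0"
  have hs: "((\<lambda>k. c k *\<^sub>C torus_monom U k) has_sum a) UNIV"
    and sm: "(\<lambda>k. cmod (c k)) summable_on UNIV"
    using assms rapidly_decreasing_abs_summable by (auto simp: has_torus_expansion_def)
  obtain F where F: "finite F" "dist (\<Sum>k\<in>F. cmod (c k)) (\<Sum>\<^sub>\<infinity>k. cmod (c k)) \<le> e"
    using infsum_finite_approximation[OF sm \<open>e > 0\<close>] by auto
  define G where "G = insert m F"
  have G: "finite G" "m \<in> G" using F by (auto simp: G_def)
  have tail: "(\<Sum>\<^sub>\<infinity>k\<in>UNIV - G. cmod (c k)) \<le> e"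
  proof -
    have "(\<Sum>\<^sub>\<infinity>k\<in>UNIV - G. cmod (c k)) = (\<Sum>\<^sub>\<infinity>k. cmod (c k)) - (\<Sum>k\<in>G. cmod (c k))"
      using infsum_Diff[OF sm, of G] G by (simp add: infsum_finite)
    moreover have "(\<Sum>k\<in>F. cmod (c k)) \<le> (\<Sum>k\<in>G. cmod (c k))"
      using F by (intro sum_mono2) (auto simp: G_def)
    ultimately show ?thesis using F(2) by (simp add: dist_real_def)
  qed
  obtain b d where bd: "norm b \<le> norm a" "((\<lambda>k. d k *\<^sub>C torus_monom U k) has_sum b) UNIV"
    "d m = c m" "\<And>k. cmod (d k) \<le> cmod (c k)" "\<And>k. k \<in> G - {m} \<Longrightarrow> d k = 0"
    using coeff_averaging[OF hs, of "G - {m}" m] G by blast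
  have "((\<lambda>k. d k *\<^sub>C torus_monom U k) has_sum (\<Sum>k\<in>G. d k *\<^sub>C torus_monom U k)) G"
    using G by (intro has_sum_finite)
  also have "(\<Sum>k\<in>G. d k *\<^sub>C torus_monom U k) = d m *\<^sub>C torus_monom U m"
    using G bd(5) by (subst sum.remove[of _ m]) (auto intro!: sum.neutral)
  finally have "((\<lambda>k. d k *\<^sub>C torus_monom U k) has_sum (b - d m *\<^sub>C torus_monom U m)) (UNIV - G)"
    by (intro has_sum_Diff bd(2)) auto
  moreover have "(\<lambda>k. cmod (c k)) summable_on UNIV - G" by (rule summable_on_subset_banach[OF sm]) auto
  hence "((\<lambda>k. cmod (c k)) has_sum (\<Sum>\<^sub>\<infinity>k\<in>UNIV - G. cmod (c k))) (UNIV - G)" by (rule has_sum_infsum)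
  ultimately have "norm (b - d m *\<^sub>C torus_monom U m) \<le> (\<Sum>\<^sub>\<infinity>k\<in>UNIV - G. cmod (c k))"
    by (rule norm_infsum_le) (simp add: norm_scaleC bd(4))
  with tail have "norm (b - d m *\<^sub>C torus_monom U m) \<le> e" by linarith
  moreover have "norm (d m *\<^sub>C torus_monom U m) \<le> norm b + norm (b - d m *\<^sub>C torus_monom U m)"
    by (metis norm_triangle_sub norm_minus_commute)
  ultimately show "cmod (c m) \<le> norm a + e" using bd(1,3) by (simp add: norm_scaleC)
qed

lemma expansion_add:
  "has_torus_expansion U a c \<Longrightarrow> has_torus_expansion U b d \<Longrightarrow> has_torus_expansion U (a + b) (\<lambda>k. c k + d k)"
  unfolding has_torus_expansion_def
  by (auto simp: scaleC_add_left intro: rapidly_decreasing_add has_sum_add)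

lemma expansion_scaleC:
  assumes "has_torus_expansion U a c"
  shows "has_torus_expansion U (z *\<^sub>C a) (\<lambda>k. z * c k)"
  unfolding has_torus_expansion_def
proof
  have "rapidly_decreasing (\<lambda>k. z * c k)"
    unfolding rapidly_decreasing_iff
    using assms by (auto simp: has_torus_expansion_def rapidly_decreasing_iff norm_mult mult.left_commute
        intro!: summable_on_cmult_right)
  thus "rapidly_decreasing (\<lambda>k. z * c k)" .
  show "((\<lambda>k. (z * c k) *\<^sub>C torus_monom U k) has_sum z *\<^sub>C a) UNIV"
    using has_sum_bounded_linear[OF bounded_linear_scaleC_right[of z], of "\<lambda>k. c k *\<^sub>C torus_monom U k" UNIV a] assms
    by (simp add: has_torus_expansion_def scaleC_scaleC)
qed

lemma expansion_unique:
  assumes "has_torus_expansion U a c" "has_torus_expansion U a d"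
  shows "c = d"
proof
  fix k
  have "has_torus_expansion U (a + (-1) *\<^sub>C a) (\<lambda>k. c k + (-1) * d k)"
    by (intro expansion_add expansion_scaleC assms)
  from coeff_bound[OF this, of k] show "c k = d k" by (simp add: scaleC_minus_left)
qed

lemma coeff_expansion: "has_torus_expansion U a c \<Longrightarrow> torus_coeff U a = c"
  unfolding torus_coeff_def by (rule the_equality) (auto dest: expansion_unique)

lemma smooth_expansion: "a \<in> smooth_elements U \<Longrightarrow> has_torus_expansion U a (torus_coeff U a)"
  unfolding smooth_elements_def using coeff_expansion by auto

end

section \<open>The algebra of smooth elements\<close>

definition weighted_norm :: "nat \<Rightarrow> (int^'n::finite \<Rightarrow> complex) \<Rightarrow> real" where
  "weighted_norm p c = (\<Sum>\<^sub>\<infinity>k. weight k ^ p * cmod (c k))"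

lemma rapidly_decreasing_summable:
  "rapidly_decreasing c \<Longrightarrow> (\<lambda>k. weight k ^ p * cmod (c k)) summable_on UNIV"
  by (simp add: rapidly_decreasing_iff)

lemma weighted_norm_has_sum:
  "rapidly_decreasing c \<Longrightarrow> ((\<lambda>k. weight k ^ p * cmod (c k)) has_sum weighted_norm p c) UNIV"
  unfolding weighted_norm_def by (intro has_sum_infsum rapidly_decreasing_summable)

lemma bij_betw_fibres: "bij_betw (\<lambda>i. (\<kappa> i, i)) UNIV (SIGMA k:UNIV. \<kappa> -` {k})"
  by (rule bij_betwI[where g = snd]) auto

text \<open>Products and power series of smooth elements arise as sums of multiples of monomials over index
  sets larger than the lattice.  Collecting the terms that belong to the same monomial yields the
  expansion; summing along the fibres of the map \<open>\<kappa>\<close> from indices to the lattice is a rearrangement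
  of an absolutely convergent sum.\<close>

lemma collected_coefficients:
  fixes \<kappa> :: "'i \<Rightarrow> int^'n::finite" and d :: "'i \<Rightarrow> complex"
  assumes sm: "\<And>p. (\<lambda>i. weight (\<kappa> i) ^ p * cmod (d i)) summable_on UNIV"
  shows "rapidly_decreasing (\<lambda>k. \<Sum>\<^sub>\<infinity>i\<in>\<kappa> -` {k}. d i)"
    and "weighted_norm p (\<lambda>k. \<Sum>\<^sub>\<infinity>i\<in>\<kappa> -` {k}. d i) \<le> (\<Sum>\<^sub>\<infinity>i. weight (\<kappa> i) ^ p * cmod (d i))"
proof -
  have *: "(\<lambda>k. weight k ^ p * cmod (\<Sum>\<^sub>\<infinity>i\<in>\<kappa> -` {k}. d i)) summable_on UNIV \<and>
     weighted_norm p (\<lambda>k. \<Sum>\<^sub>\<infinity>i\<in>\<kappa> -` {k}. d i) \<le> (\<Sum>\<^sub>\<infinity>i. weight (\<kappa> i) ^ p * cmod (d i))" for p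
  proof -
    let ?f = "\<lambda>(k, i). weight (\<kappa> i) ^ p * cmod (d i)"
    let ?S = "\<lambda>k. \<Sum>\<^sub>\<infinity>i\<in>\<kappa> -` {k}. weight (\<kappa> i) ^ p * cmod (d i)"
    have hs: "(?f has_sum (\<Sum>\<^sub>\<infinity>i. weight (\<kappa> i) ^ p * cmod (d i))) (SIGMA k:UNIV. \<kappa> -` {k})"
      by (subst has_sum_reindex_bij_betw[OF bij_betw_fibres[of \<kappa>], symmetric])
         (simp add: has_sum_infsum[OF sm])
    have fib: "(\<lambda>i. weight (\<kappa> i) ^ p * cmod (d i)) summable_on \<kappa> -` {k}" for k
      by (rule summable_on_subset_banach[OF sm]) auto
    have S: "(?S has_sum (\<Sum>\<^sub>\<infinity>i. weight (\<kappa> i) ^ p * cmod (d i))) UNIV"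
      by (rule has_sum_SigmaD[OF hs]) (simp add: has_sum_infsum[OF fib])
    have le: "weight k ^ p * cmod (\<Sum>\<^sub>\<infinity>i\<in>\<kappa> -` {k}. d i) \<le> ?S k" for k
    proof -
      have "(\<lambda>i. cmod (d i)) summable_on \<kappa> -` {k}"
        using summable_on_subset_banach[OF sm[of 0], of "\<kappa> -` {k}"] by simp
      hence "weight k ^ p * cmod (\<Sum>\<^sub>\<infinity>i\<in>\<kappa> -` {k}. d i) \<le> weight k ^ p * (\<Sum>\<^sub>\<infinity>i\<in>\<kappa> -` {k}. cmod (d i))"
        by (intro mult_left_mono norm_infsum_bound) (simp_all add: weight_nonneg)
      also have "\<dots> = (\<Sum>\<^sub>\<infinity>i\<in>\<kappa> -` {k}. weight k ^ p * cmod (d i))"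
        by (rule infsum_cmult_right'[symmetric])
      also have "\<dots> = ?S k" by (rule infsum_cong) auto
      finally show ?thesis .
    qed
    have sm': "(\<lambda>k. weight k ^ p * cmod (\<Sum>\<^sub>\<infinity>i\<in>\<kappa> -` {k}. d i)) summable_on UNIV"
      by (rule summable_on_comparison_test[OF has_sum_imp_summable[OF S] le]) (simp add: weight_nonneg)
    have "weighted_norm p (\<lambda>k. \<Sum>\<^sub>\<infinity>i\<in>\<kappa> -` {k}. d i) \<le> (\<Sum>\<^sub>\<infinity>k. ?S k)"
      unfolding weighted_norm_def by (rule infsum_mono[OF sm' has_sum_imp_summable[OF S] le])
    also have "\<dots> = (\<Sum>\<^sub>\<infinity>i. weight (\<kappa> i) ^ p * cmod (d i))" using S by (rule infsumI)
    finally show ?thesis using sm' by blast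
  qed
  show "rapidly_decreasing (\<lambda>k. \<Sum>\<^sub>\<infinity>i\<in>\<kappa> -` {k}. d i)"
    unfolding rapidly_decreasing_iff using * by blast
  show "weighted_norm p (\<lambda>k. \<Sum>\<^sub>\<infinity>i\<in>\<kappa> -` {k}. d i) \<le> (\<Sum>\<^sub>\<infinity>i. weight (\<kappa> i) ^ p * cmod (d i))"
    using * by blast
qed

lemma has_sum_indicator_point:
  fixes x :: "'b::{comm_monoid_add,topological_space}"
  shows "((\<lambda>k. if k = m then x else 0) has_sum x) UNIV"
proof -
  have "((\<lambda>k. if k = m then x else 0) has_sum x) {m}"
    using has_sum_finite[of "{m}" "\<lambda>k. if k = m then x else 0"] by simp
  thus ?thesis by (rule has_sum_cong_neutral[THEN iffD1, rotated -1]) auto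
qed

context nc_torus
begin

lemma monomials_abs_summable:
  assumes "(\<lambda>i. cmod (d i)) summable_on A"
  shows "(\<lambda>i. d i *\<^sub>C torus_monom U (\<kappa> i)) summable_on A"
  by (rule abs_summable_summable) (simp add: norm_scaleC assms)

lemma expansion_collect:
  fixes \<kappa> :: "'i \<Rightarrow> int^'n::{finite,linorder}" and d :: "'i \<Rightarrow> complex"
  assumes sm: "\<And>p. (\<lambda>i. weight (\<kappa> i) ^ p * cmod (d i)) summable_on UNIV"
    and hs: "((\<lambda>i. d i *\<^sub>C torus_monom U (\<kappa> i)) has_sum a) UNIV"
  shows "has_torus_expansion U a (\<lambda>k. \<Sum>\<^sub>\<infinity>i\<in>\<kappa> -` {k}. d i)"
  unfolding has_torus_expansion_def
proof
  let ?f = "\<lambda>(k, i). d i *\<^sub>C torus_monom U (\<kappa> i)"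
  have "(?f has_sum a) (SIGMA k:UNIV. \<kappa> -` {k})"
    by (subst has_sum_reindex_bij_betw[OF bij_betw_fibres[of \<kappa>], symmetric]) (simp add: hs)
  thus "((\<lambda>k. (\<Sum>\<^sub>\<infinity>i\<in>\<kappa> -` {k}. d i) *\<^sub>C torus_monom U k) has_sum a) UNIV"
  proof (rule has_sum_SigmaD)
    fix k
    have "(\<lambda>i. cmod (d i)) summable_on \<kappa> -` {k}"
      using summable_on_subset_banach[OF sm[of 0], of "\<kappa> -` {k}"] by simp
    hence "d summable_on \<kappa> -` {k}" by (rule abs_summable_summable)
    from has_sum_bounded_linear[OF bounded_linear_scaleC_left has_sum_infsum[OF this]]
    have "((\<lambda>i. d i *\<^sub>C torus_monom U k) has_sum ((\<Sum>\<^sub>\<infinity>i\<in>\<kappa> -` {k}. d i) *\<^sub>C torus_monom U k)) (\<kappa> -` {k})" .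
    thus "((\<lambda>i. ?f (k, i)) has_sum ((\<Sum>\<^sub>\<infinity>i\<in>\<kappa> -` {k}. d i) *\<^sub>C torus_monom U k)) (\<kappa> -` {k})"
      by (rule has_sum_cong[THEN iffD1, rotated]) auto
  qed
qed (rule collected_coefficients(1)[OF sm])

text \<open>The coefficients of a product: those of the group algebra, twisted by the cocycle.\<close>

definition twisted_convolution :: "(int^'n::{finite,linorder} \<Rightarrow> complex) \<Rightarrow> (int^'n::{finite,linorder} \<Rightarrow> complex) \<Rightarrow> int^'n::{finite,linorder} \<Rightarrow> complex" where
  "twisted_convolution c d m = (\<Sum>\<^sub>\<infinity>(k, l)\<in>(\<lambda>(k, l). k + l) -` {m}. c k * d l * twist k l)"

lemma twisted_convolution_summable:
  assumes c: "rapidly_decreasing c" and d: "rapidly_decreasing d"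
  shows "(\<lambda>(k, l). weight (k + l) ^ p * cmod (c k * d l * twist k l)) summable_on UNIV"
    and "(\<Sum>\<^sub>\<infinity>(k, l). weight (k + l) ^ p * cmod (c k * d l * twist k l)) \<le> weighted_norm p c * weighted_norm p d"
proof -
  let ?f = "\<lambda>(k, l). (weight k ^ p * cmod (c k)) * (weight l ^ p * cmod (d l))"
  let ?g = "\<lambda>(k, l). weight (k + l) ^ p * cmod (c k * d l * twist k l)"
  have inner: "((\<lambda>l. ?f (k, l)) has_sum (weight k ^ p * cmod (c k)) * weighted_norm p d) UNIV" for k
    using has_sum_cmult_right[OF weighted_norm_has_sum[OF d]] by simp
  have outer: "((\<lambda>k. (weight k ^ p * cmod (c k)) * weighted_norm p d) has_sum weighted_norm p c * weighted_norm p d) UNIV"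
    by (rule has_sum_cmult_left[OF weighted_norm_has_sum[OF c]])
  have "?f summable_on (UNIV \<times> UNIV)"
    by (rule summable_on_SigmaI[OF inner has_sum_imp_summable[OF outer]]) (simp add: weight_nonneg)
  hence "(?f has_sum weighted_norm p c * weighted_norm p d) (UNIV \<times> UNIV)"
    by (rule has_sum_SigmaI[OF inner outer])
  hence f: "(?f has_sum weighted_norm p c * weighted_norm p d) UNIV" by simp
  have le: "?g x \<le> ?f x" for x
  proof (cases x)
    case (Pair k l)
    have "weight (k + l) ^ p \<le> weight k ^ p * weight l ^ p"
      unfolding power_mult_distrib[symmetric] by (intro power_mono weight_add_le weight_nonneg)
    from mult_right_mono[OF this, of "cmod (c k) * cmod (d l)"] show ?thesis
      by (simp add: Pair norm_mult mult_ac)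
  qed
  show g: "?g summable_on UNIV"
    by (rule summable_on_comparison_test[OF has_sum_imp_summable[OF f] le]) (auto simp: weight_nonneg)
  show "infsum ?g UNIV \<le> weighted_norm p c * weighted_norm p d"
    using infsum_mono[OF g has_sum_imp_summable[OF f] le] infsumI[OF f] by simp
qed

lemma weighted_norm_twisted_convolution:
  assumes c: "rapidly_decreasing c" and d: "rapidly_decreasing d"
  shows "weighted_norm p (twisted_convolution c d) \<le> weighted_norm p c * weighted_norm p d"
proof -
  have "weighted_norm p (\<lambda>m. \<Sum>\<^sub>\<infinity>i\<in>(\<lambda>(k, l). k + l) -` {m}. (\<lambda>(k, l). c k * d l * twist k l) i)
    \<le> (\<Sum>\<^sub>\<infinity>i. weight ((\<lambda>(k, l). k + l) i) ^ p * cmod ((\<lambda>(k, l). c k * d l * twist k l) i))"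
    by (rule collected_coefficients(2)) (use twisted_convolution_summable(1)[OF c d] in \<open>simp add: case_prod_unfold\<close>)
  also have "\<dots> \<le> weighted_norm p c * weighted_norm p d"
    using twisted_convolution_summable(2)[OF c d] by (simp add: case_prod_unfold)
  finally show ?thesis unfolding twisted_convolution_def[abs_def] .
qed

lemma expansion_mult:
  assumes a: "has_torus_expansion U a c" and b: "has_torus_expansion U b d"
  shows "has_torus_expansion U (a * b) (twisted_convolution c d)"
proof -
  have rc: "rapidly_decreasing c" and rd: "rapidly_decreasing d"
    and ha: "((\<lambda>k. c k *\<^sub>C torus_monom U k) has_sum a) UNIV"
    and hb: "((\<lambda>k. d k *\<^sub>C torus_monom U k) has_sum b) UNIV"
    using a b by (auto simp: has_torus_expansion_def)
  let ?f = "\<lambda>(k, l). (c k * d l * twist k l) *\<^sub>C torus_monom U (k + l)"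
  have inner: "((\<lambda>l. ?f (k, l)) has_sum (c k *\<^sub>C torus_monom U k) * b) UNIV" for k
    using has_sum_bounded_linear[OF bounded_linear_mult_right hb, of "c k *\<^sub>C torus_monom U k"]
    by (simp add: scaleC_mult_left scaleC_mult_right scaleC_scaleC monom_mult mult_ac)
  have outer: "((\<lambda>k. (c k *\<^sub>C torus_monom U k) * b) has_sum a * b) UNIV"
    by (rule has_sum_bounded_linear[OF bounded_linear_mult_left ha])
  have "(\<lambda>i. cmod ((\<lambda>(k, l). c k * d l * twist k l) i)) summable_on UNIV"
    using twisted_convolution_summable(1)[OF rc rd, of 0] by (simp add: case_prod_unfold)
  from monomials_abs_summable[OF this, of "\<lambda>(k, l). k + l"]
  have "?f summable_on UNIV \<times> UNIV" by (simp add: case_prod_unfold)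
  hence "(?f has_sum a * b) (UNIV \<times> UNIV)" by (rule has_sum_SigmaI[OF inner outer])
  hence f: "(?f has_sum a * b) UNIV" by simp
  have "has_torus_expansion U (a * b) (\<lambda>m. \<Sum>\<^sub>\<infinity>i\<in>(\<lambda>(k, l). k + l) -` {m}. (\<lambda>(k, l). c k * d l * twist k l) i)"
    by (rule expansion_collect)
       (use twisted_convolution_summable(1)[OF rc rd] f in \<open>simp_all add: case_prod_unfold\<close>)
  thus ?thesis unfolding twisted_convolution_def[abs_def] .
qed

lemma expansion_delta: "has_torus_expansion U (z *\<^sub>C torus_monom U m) (\<lambda>k. if k = m then z else 0)"
  and weighted_norm_delta: "weighted_norm p (\<lambda>k::int^'n::{finite,linorder}. if k = m then z else 0) = weight m ^ p * cmod z"
proof -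
  have *: "((\<lambda>k. weight k ^ p * cmod (if k = m then z else 0)) has_sum (weight m ^ p * cmod z)) UNIV" for p
    using has_sum_indicator_point[of m "weight m ^ p * cmod z"] by (rule has_sum_cong[THEN iffD1, rotated]) auto
  show "weighted_norm p (\<lambda>k::int^'n::{finite,linorder}. if k = m then z else 0) = weight m ^ p * cmod z"
    unfolding weighted_norm_def using * by (rule infsumI)
  have "((\<lambda>k. (if k = m then z else 0) *\<^sub>C torus_monom U k) has_sum (z *\<^sub>C torus_monom U m)) UNIV"
    using has_sum_indicator_point[of m "z *\<^sub>C torus_monom U m"] by (rule has_sum_cong[THEN iffD1, rotated]) auto
  thus "has_torus_expansion U (z *\<^sub>C torus_monom U m) (\<lambda>k. if k = m then z else 0)"
    using has_sum_imp_summable[OF *] by (simp add: has_torus_expansion_def rapidly_decreasing_iff)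
qed

lemma expansion_star:
  assumes "has_torus_expansion U a c"
  shows "has_torus_expansion U (star a) (\<lambda>k. cnj (c (- k)) * cnj (twist (- k) k))"
  unfolding has_torus_expansion_def
proof
  have bij: "bij_betw uminus (UNIV :: (int^'n::{finite,linorder}) set) UNIV"
    by (rule bij_betwI[where g = uminus]) auto
  have rc: "rapidly_decreasing c" and hs: "((\<lambda>k. c k *\<^sub>C torus_monom U k) has_sum a) UNIV"
    using assms by (auto simp: has_torus_expansion_def)
  show "rapidly_decreasing (\<lambda>k. cnj (c (- k)) * cnj (twist (- k) k))"
    unfolding rapidly_decreasing_iff
    using rapidly_decreasing_summable[OF rc]
    by (subst (asm) summable_on_reindex_bij_betw[OF bij, symmetric]) (simp add: norm_mult weight_uminus)
  have "((\<lambda>k. star (c k *\<^sub>C torus_monom U k)) has_sum star a) UNIV"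
    by (rule has_sum_bounded_linear[OF bounded_linear_star hs])
  thus "((\<lambda>k. (cnj (c (- k)) * cnj (twist (- k) k)) *\<^sub>C torus_monom U k) has_sum star a) UNIV"
    by (subst (asm) has_sum_reindex_bij_betw[OF bij, symmetric])
       (simp add: star_scaleC star_monom scaleC_scaleC)
qed

lemma expansion_deriv:
  assumes "has_torus_expansion U a c"
  shows "has_torus_expansion U (torus_deriv U j a) (\<lambda>k. of_int (k $ j) * c k)"
proof -
  have rc: "rapidly_decreasing c" using assms by (auto simp: has_torus_expansion_def)
  have r: "rapidly_decreasing (\<lambda>k. of_int (k $ j) * c k)"
    by (rule rapidly_decreasing_bounded_factor[OF rc, of _ 1])
       (simp add: norm_mult mult_right_mono weight_component)
  show ?thesis
    unfolding has_torus_expansion_def torus_deriv_def coeff_expansion[OF assms]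
    by (intro conjI r has_sum_infsum monomials_abs_summable rapidly_decreasing_abs_summable)
qed

lemma smooth_mult: "a \<in> smooth_elements U \<Longrightarrow> b \<in> smooth_elements U \<Longrightarrow> a * b \<in> smooth_elements U"
  unfolding smooth_elements_def using expansion_mult by blast

lemma smooth_add: "a \<in> smooth_elements U \<Longrightarrow> b \<in> smooth_elements U \<Longrightarrow> a + b \<in> smooth_elements U"
  unfolding smooth_elements_def using expansion_add by blast

lemma smooth_scaleC: "a \<in> smooth_elements U \<Longrightarrow> z *\<^sub>C a \<in> smooth_elements U"
  unfolding smooth_elements_def using expansion_scaleC by blast

lemma smooth_scaleR: "a \<in> smooth_elements U \<Longrightarrow> r *\<^sub>R a \<in> smooth_elements U"
  by (metis scaleC_of_real smooth_scaleC)

lemma smooth_deriv: "a \<in> smooth_elements U \<Longrightarrow> torus_deriv U j a \<in> smooth_elements U"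
  unfolding smooth_elements_def using expansion_deriv by blast

lemma smooth_star: "a \<in> smooth_elements U \<Longrightarrow> star a \<in> smooth_elements U"
  unfolding smooth_elements_def using expansion_star by blast

lemma expansion_one: "has_torus_expansion U 1 (\<lambda>k. if k = 0 then 1 else 0)"
  using expansion_delta[of 1 0] by simp

lemma smooth_one: "1 \<in> smooth_elements U"
  unfolding smooth_elements_def using expansion_one by blast

lemma smooth_zero: "0 \<in> smooth_elements U"
  using smooth_scaleC[OF smooth_one, of 0] by simp

lemma smooth_minus: "a \<in> smooth_elements U \<Longrightarrow> - a \<in> smooth_elements U"
  using smooth_scaleR[of a "-1"] by simp

lemma smooth_diff: "a \<in> smooth_elements U \<Longrightarrow> b \<in> smooth_elements U \<Longrightarrow> a - b \<in> smooth_elements U"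
  using smooth_add[of a "- b"] smooth_minus[of b] by simp

lemma smooth_sum: "(\<And>i. i \<in> A \<Longrightarrow> a i \<in> smooth_elements U) \<Longrightarrow> sum a A \<in> smooth_elements U"
  by (induction A rule: infinite_finite_induct) (auto intro: smooth_zero smooth_add)

text \<open>The bound is uniform in the weight, with the same coefficients \<open>d\<close> for every \<open>p\<close>; it dominates the
  exponential series in all weighted norms at once.\<close>

lemma power_expansion:
  assumes a: "has_torus_expansion U a c"
  shows "\<exists>d. has_torus_expansion U (a ^ n) d \<and> (\<forall>p. weighted_norm p d \<le> weighted_norm p c ^ n)"
proof (induction n)
  case 0
  show ?case
    by (intro exI[of _ "\<lambda>k. if k = 0 then 1 else 0"]) (simp add: expansion_one weighted_norm_delta weight_def)
next
  case (Suc n)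
  then obtain d where d: "has_torus_expansion U (a ^ n) d" "\<And>p. weighted_norm p d \<le> weighted_norm p c ^ n"
    by blast
  have "weighted_norm p (twisted_convolution c d) \<le> weighted_norm p c ^ Suc n" for p
  proof -
    have "weighted_norm p (twisted_convolution c d) \<le> weighted_norm p c * weighted_norm p d"
      using a d by (intro weighted_norm_twisted_convolution) (auto simp: has_torus_expansion_def)
    also have "\<dots> \<le> weighted_norm p c * weighted_norm p c ^ n"
      by (intro mult_left_mono d) (simp add: weighted_norm_def infsum_nonneg weight_nonneg)
    finally show ?thesis by simp
  qed
  thus ?case using expansion_mult[OF a d(1)] by auto
qed

text \<open>By \<open>power_expansion\<close> the exponential series converges in every weighted norm, so its terms,
  indexed by a power and a lattice point, can be collected to an expansion.\<close>

lemma smooth_exp: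
  assumes "a \<in> smooth_elements U"
  shows "exp a \<in> smooth_elements U"
proof -
  obtain c where a: "has_torus_expansion U a c" using assms by (auto simp: smooth_elements_def)
  obtain d where d: "\<And>n. has_torus_expansion U (a ^ n) (d n)"
    "\<And>n p. weighted_norm p (d n) \<le> weighted_norm p c ^ n"
    using power_expansion[OF a] by metis
  have rd: "rapidly_decreasing (d n)"
    and hd: "((\<lambda>k. d n k *\<^sub>C torus_monom U k) has_sum a ^ n) UNIV" for n
    using d(1)[of n] by (auto simp: has_torus_expansion_def)
  define e where "e = (\<lambda>(n, k). d n k / of_nat (fact n))"
  have sm: "(\<lambda>i. weight (snd i) ^ p * cmod (e i)) summable_on UNIV" for p
  proof -
    have "(\<lambda>i. weight (snd i) ^ p * cmod (e i)) summable_on UNIV \<times> UNIV"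
    proof (rule summable_on_SigmaI)
      show "((\<lambda>k. weight (snd (n, k)) ^ p * cmod (e (n, k))) has_sum weighted_norm p (d n) / fact n) UNIV" for n
        using has_sum_cmult_left[OF weighted_norm_has_sum[OF rd[of n], of p], of "1 / fact n"]
        by (simp add: e_def norm_divide)
      have "(\<lambda>n. weighted_norm p c ^ n /\<^sub>R fact n) summable_on UNIV"
        by (intro norm_summable_imp_summable_on summable_norm_exp)
      thus "(\<lambda>n. weighted_norm p (d n) / fact n) summable_on UNIV"
        by (rule summable_on_comparison_test)
           (use d(2) in \<open>auto simp: divide_inverse weighted_norm_def intro!: mult_left_mono infsum_nonneg mult_nonneg_nonneg\<close>,
            simp add: mult.commute mult_left_mono, simp add: weight_nonneg)
    qed (simp add: weight_nonneg)
    thus ?thesis by simp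
  qed
  have "((\<lambda>i. e i *\<^sub>C torus_monom U (snd i)) has_sum exp a) (UNIV \<times> UNIV)"
  proof (rule has_sum_SigmaI)
    show "((\<lambda>k. e (n, k) *\<^sub>C torus_monom U (snd (n, k))) has_sum (a ^ n /\<^sub>R fact n)) UNIV" for n
      using has_sum_bounded_linear[OF bounded_linear_scaleC_right[of "1 / of_nat (fact n)"] hd[of n]]
        scaleC_of_real[of "1 / fact n" "a ^ n"]
      by (simp add: e_def scaleC_scaleC divide_inverse mult.commute)
    show "((\<lambda>n. a ^ n /\<^sub>R fact n) has_sum exp a) UNIV"
      by (intro norm_summable_imp_has_sum summable_norm_exp exp_converges)
    have "(\<lambda>i. cmod (e i)) summable_on UNIV" using sm[of 0] by simp
    from monomials_abs_summable[OF this]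
    show "(\<lambda>i. e i *\<^sub>C torus_monom U (snd i)) summable_on UNIV \<times> UNIV" by simp
  qed
  hence "((\<lambda>i. e i *\<^sub>C torus_monom U (snd i)) has_sum exp a) UNIV" by simp
  from expansion_collect[OF sm this] show ?thesis by (auto simp: smooth_elements_def)
qed

lemma expansion_eqI: "has_torus_expansion U a c \<Longrightarrow> has_torus_expansion U b c \<Longrightarrow> a = b"
  unfolding has_torus_expansion_def using has_sum_unique by blast

lemma deriv_mult:
  assumes a: "a \<in> smooth_elements U" and b: "b \<in> smooth_elements U"
  shows "torus_deriv U j (a * b) = torus_deriv U j a * b + a * torus_deriv U j b"
proof -
  obtain c d where c: "has_torus_expansion U a c" and d: "has_torus_expansion U b d"
    using a b by (auto simp: smooth_elements_def)
  define c' where "c' k = of_int (k $ j) * c k" for k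
  define d' where "d' k = of_int (k $ j) * d k" for k
  have c': "has_torus_expansion U (torus_deriv U j a) c'" and d': "has_torus_expansion U (torus_deriv U j b) d'"
    using expansion_deriv[OF c, of j] expansion_deriv[OF d, of j] by (simp_all add: c'_def[abs_def] d'_def[abs_def])
  note rapid = c[unfolded has_torus_expansion_def, THEN conjunct1] d[unfolded has_torus_expansion_def, THEN conjunct1]
    c'[unfolded has_torus_expansion_def, THEN conjunct1] d'[unfolded has_torus_expansion_def, THEN conjunct1]
  have sm: "(\<lambda>(k, l). x k * y l * twist k l) summable_on A"
    if "rapidly_decreasing x" "rapidly_decreasing y" for x y A
    by (rule abs_summable_summable, rule summable_on_subset_banach[of _ UNIV])
       (use twisted_convolution_summable(1)[OF that, of 0] in \<open>simp_all add: case_prod_unfold\<close>)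
  have "of_int (m $ j) * twisted_convolution c d m = twisted_convolution c' d m + twisted_convolution c d' m" for m
  proof -
    have "twisted_convolution c' d m + twisted_convolution c d' m = (\<Sum>\<^sub>\<infinity>i\<in>(\<lambda>(k, l). k + l) -` {m}.
        (\<lambda>(k, l). c' k * d l * twist k l) i + (\<lambda>(k, l). c k * d' l * twist k l) i)"
      unfolding twisted_convolution_def by (rule infsum_add[symmetric]) (intro sm rapid)+
    also have "\<dots> = (\<Sum>\<^sub>\<infinity>i\<in>(\<lambda>(k, l). k + l) -` {m}. of_int (m $ j) * (\<lambda>(k, l). c k * d l * twist k l) i)"
      by (rule infsum_cong) (auto simp: c'_def d'_def algebra_simps)
    also have "\<dots> = of_int (m $ j) * twisted_convolution c d m"
      unfolding twisted_convolution_def by (rule infsum_cmult_right')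
    finally show ?thesis by simp
  qed
  hence "has_torus_expansion U (torus_deriv U j (a * b)) (\<lambda>m. twisted_convolution c' d m + twisted_convolution c d' m)"
    using expansion_deriv[OF expansion_mult[OF c d], of j] by simp
  moreover have "has_torus_expansion U (torus_deriv U j a * b + a * torus_deriv U j b) (\<lambda>m. twisted_convolution c' d m + twisted_convolution c d' m)"
    by (intro expansion_add expansion_mult c d c' d')
  ultimately show ?thesis by (rule expansion_eqI)
qed

lemma deriv_scaleR:
  assumes "a \<in> smooth_elements U" shows "torus_deriv U j (r *\<^sub>R a) = r *\<^sub>R torus_deriv U j a"
proof -
  obtain c where c: "has_torus_expansion U a c" using assms by (auto simp: smooth_elements_def)
  show ?thesis
    using expansion_eqI[OF expansion_deriv[OF expansion_scaleC[OF c, of "of_real r"], of j]]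
      expansion_scaleC[OF expansion_deriv[OF c, of j], of "of_real r"]
    by (simp add: scaleC_of_real mult.left_commute)
qed

lemma deriv_zero: "torus_deriv U j 0 = 0"
  using deriv_scaleR[OF smooth_one, of j 0] by simp

lemma deriv_star:
  assumes "a \<in> smooth_elements U" shows "torus_deriv U j (star a) = - star (torus_deriv U j a)"
proof -
  obtain c where c: "has_torus_expansion U a c" using assms by (auto simp: smooth_elements_def)
  have "has_torus_expansion U (torus_deriv U j (star a)) (\<lambda>k. of_int (k $ j) * (cnj (c (- k)) * cnj (twist (- k) k)))"
    by (intro expansion_deriv expansion_star c)
  moreover have "has_torus_expansion U ((-1) *\<^sub>C star (torus_deriv U j a))
      (\<lambda>k. (-1) * (cnj (of_int ((- k) $ j) * c (- k)) * cnj (twist (- k) k)))"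
    by (intro expansion_scaleC expansion_star expansion_deriv c)
  ultimately have "torus_deriv U j (star a) = (-1) *\<^sub>C star (torus_deriv U j a)"
    by (intro expansion_eqI) (simp_all add: mult.assoc)
  thus ?thesis by (simp add: scaleC_minus_left)
qed

text \<open>All derivatives vanish only if every coefficient with a nonzero index vanishes.\<close>

lemma constant_if_deriv_zero:
  assumes "a \<in> smooth_elements U" and "\<And>j. torus_deriv U j a = 0"
  shows "\<exists>z. a = z *\<^sub>C 1"
proof -
  obtain c where c: "has_torus_expansion U a c" using assms by (auto simp: smooth_elements_def)
  have 0: "has_torus_expansion U 0 (\<lambda>k. 0)" using expansion_scaleC[OF expansion_one, of 0] by simp
  have "of_int (k $ j) * c k = 0" for k j
    using expansion_unique[OF expansion_deriv[OF c, of j]] 0 assms(2)[of j] by (simp add: fun_eq_iff)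
  hence "c k = (if k = 0 then c 0 else 0)" for k
    by (metis mult_eq_0_iff of_int_eq_0_iff vec_eq_iff zero_index)
  hence "has_torus_expansion U a (\<lambda>k. if k = 0 then c 0 else 0)"
    using c by (subst (asm) ext[of c "\<lambda>k. if k = 0 then c 0 else 0"]) auto
  with expansion_delta[of "c 0" 0] have "a = c 0 *\<^sub>C 1" by (metis expansion_eqI monom_zero)
  thus ?thesis ..
qed

lemma trace_add:
  "a \<in> smooth_elements U \<Longrightarrow> b \<in> smooth_elements U \<Longrightarrow> torus_trace U (a + b) = torus_trace U a + torus_trace U b"
  unfolding torus_trace_def by (metis (no_types, lifting) coeff_expansion expansion_add smooth_expansion)

lemma trace_scaleC:
  "a \<in> smooth_elements U \<Longrightarrow> torus_trace U (z *\<^sub>C a) = z * torus_trace U a"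
  unfolding torus_trace_def by (metis (no_types, lifting) coeff_expansion expansion_scaleC smooth_expansion)

lemma trace_scaleR:
  "a \<in> smooth_elements U \<Longrightarrow> torus_trace U (r *\<^sub>R a) = of_real r * torus_trace U a"
  using trace_scaleC[of a "of_real r"] by (simp add: scaleC_of_real)

lemma trace_sum:
  "(\<And>i. i \<in> A \<Longrightarrow> a i \<in> smooth_elements U) \<Longrightarrow> torus_trace U (sum a A) = (\<Sum>i\<in>A. torus_trace U (a i))"
proof (induction A rule: infinite_finite_induct)
  case (insert x F)
  thus ?case by (simp add: trace_add smooth_sum)
qed (use trace_scaleR[OF smooth_one, of 0] in simp_all)

lemma trace_deriv: "a \<in> smooth_elements U \<Longrightarrow> torus_trace U (torus_deriv U j a) = 0"
  unfolding torus_trace_def using coeff_expansion[OF expansion_deriv[OF smooth_expansion], of a j] by simp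

text \<open>Only the pairs \<open>(k, - k)\<close> contribute to the coefficient of the unit.\<close>

lemma trace_mult:
  assumes "has_torus_expansion U a c" "has_torus_expansion U b d"
  shows "torus_trace U (a * b) = (\<Sum>\<^sub>\<infinity>k. c k * d (- k) * twist k (- k))"
proof -
  have bij: "bij_betw (\<lambda>k::int^'n::{finite,linorder}. (k, - k)) UNIV ((\<lambda>(k, l). k + l) -` {0})"
    by (rule bij_betwI[where g = fst]) (auto simp: eq_neg_iff_add_eq_0 add.commute neg_eq_iff_add_eq_0)
  have "torus_trace U (a * b) = twisted_convolution c d 0"
    unfolding torus_trace_def coeff_expansion[OF expansion_mult[OF assms]] ..
  also have "\<dots> = (\<Sum>\<^sub>\<infinity>k. c k * d (- k) * twist k (- k))"
    unfolding twisted_convolution_def by (subst infsum_reindex_bij_betw[OF bij, symmetric]) simp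
  finally show ?thesis .
qed

lemma trace_commute:
  assumes "a \<in> smooth_elements U" "b \<in> smooth_elements U"
  shows "torus_trace U (a * b) = torus_trace U (b * a)"
proof -
  obtain c d where c: "has_torus_expansion U a c" and d: "has_torus_expansion U b d"
    using assms by (auto simp: smooth_elements_def)
  have bij: "bij_betw uminus (UNIV :: (int^'n::{finite,linorder}) set) UNIV"
    by (rule bij_betwI[where g = uminus]) auto
  show ?thesis
    unfolding trace_mult[OF c d] trace_mult[OF d c]
    by (subst infsum_reindex_bij_betw[OF bij, symmetric]) (simp add: twist_uminus mult_ac)
qed

text \<open>The phase from \<open>(U\<^sup>k)\<^sup>*\<close> is the conjugate of the cocycle value that \<open>U\<^sup>-\<^sup>k U\<^sup>k\<close> produces, so the two
  cancel and the trace is \<open>\<Sum>\<^sub>k \<bar>c\<^sub>k\<bar>\<^sup>2\<close>.\<close>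

lemma trace_star_mult_self:
  assumes "x \<in> smooth_elements U"
  obtains r where "torus_trace U (star x * x) = complex_of_real r" "r \<ge> 0" "r = 0 \<Longrightarrow> x = 0"
proof -
  obtain c where c: "has_torus_expansion U x c" using assms by (auto simp: smooth_elements_def)
  define r where "r = (\<Sum>\<^sub>\<infinity>k. (cmod (c k))\<^sup>2)"
  have bij: "bij_betw uminus (UNIV :: (int^'n::{finite,linorder}) set) UNIV"
    by (rule bij_betwI[where g = uminus]) auto
  have sm: "(\<lambda>k. (cmod (c k))\<^sup>2) summable_on UNIV"
  proof (rule summable_on_comparison_test)
    show "(\<lambda>k. norm x * cmod (c k)) summable_on UNIV"
      using c by (intro summable_on_cmult_right rapidly_decreasing_abs_summable) (simp add: has_torus_expansion_def)
    show "(cmod (c k))\<^sup>2 \<le> norm x * cmod (c k)" for k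
      unfolding power2_eq_square by (intro mult_right_mono coeff_bound[OF c]) simp
  qed simp
  have unit: "cnj (twist k (- k)) * twist k (- k) = 1" for k
    using complex_norm_square[of "twist k (- k)"] by (simp add: mult.commute)
  have "torus_trace U (star x * x) = (\<Sum>\<^sub>\<infinity>k. cnj (c (- k)) * cnj (twist (- k) k) * c (- k) * twist k (- k))"
    by (rule trace_mult[OF expansion_star[OF c] c])
  also have "\<dots> = (\<Sum>\<^sub>\<infinity>k. of_real ((cmod (c (- k)))\<^sup>2))"
  proof (rule infsum_cong)
    fix k
    have "cnj (c (- k)) * cnj (twist (- k) k) * c (- k) * twist k (- k)
        = (c (- k) * cnj (c (- k))) * (cnj (twist k (- k)) * twist k (- k))"
      by (simp add: twist_uminus mult_ac)
    thus "cnj (c (- k)) * cnj (twist (- k) k) * c (- k) * twist k (- k) = of_real ((cmod (c (- k)))\<^sup>2)"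
      by (simp add: unit complex_norm_square[symmetric])
  qed
  also have "\<dots> = (\<Sum>\<^sub>\<infinity>k. of_real ((cmod (c k))\<^sup>2))"
    by (rule infsum_reindex_bij_betw[OF bij])
  also have "\<dots> = of_real r" unfolding r_def
    by (rule infsumI, rule has_sum_bounded_linear[OF bounded_linear_of_real has_sum_infsum[OF sm]])
  finally have tr: "torus_trace U (star x * x) = of_real r" .
  have "x = 0" if "r = 0"
  proof -
    have "(cmod (c k))\<^sup>2 \<le> r" for k
      using finite_sum_le_infsum[OF sm, of "{k}"] by (simp add: r_def)
    with that have "c k = 0" for k by (metis norm_eq_zero power2_less_eq_zero_iff)
    hence "c = (\<lambda>k. 0)" by auto
    with c have "has_torus_expansion U x (\<lambda>k. 0)" by simp
    moreover have "has_torus_expansion U 0 (\<lambda>k. 0)" using expansion_scaleC[OF expansion_one, of 0] by simp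
    ultimately show ?thesis by (rule expansion_eqI)
  qed
  moreover have "r \<ge> 0" unfolding r_def by (rule infsum_nonneg) simp
  ultimately show thesis using tr that by blast
qed

end

section \<open>Metrics and connections in coordinates\<close>

lemma matrix_inv_unique:
  fixes A :: "'a::semiring_1^'n^'n"
  assumes "A ** B = mat 1" "B ** A = mat 1"
  shows "matrix_inv A = B"
proof -
  have "A ** matrix_inv A = mat 1 \<and> matrix_inv A ** A = mat 1"
    unfolding matrix_inv_def by (rule someI[of _ B]) (use assms in simp)
  thus ?thesis using assms by (metis matrix_mul_assoc matrix_mul_lid matrix_mul_rid)
qed

lemma matrix_inv_scalar:
  fixes a b :: "'a::ring_1"
  assumes "a * b = 1" "b * a = 1"
  shows "matrix_inv (\<chi> i j. if i = j then a else 0 :: 'a^'n^'n) = (\<chi> i j. if i = j then b else 0)"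
  by (rule matrix_inv_unique)
     (simp_all add: matrix_matrix_mult_def mat_def vec_eq_iff if_distrib[of "\<lambda>x. _ * x"]
        if_distrib[of "\<lambda>x. x * _"] assms cong: if_cong)

lemma sum_smult_axis: "(\<Sum>j\<in>UNIV. v j *s axis j 1) = (vec_lambda v :: 'a::semiring_1^'n)"
  by (simp add: vec_eq_iff axis_def if_distrib[of "\<lambda>x. _ * x"] cong: if_cong)

context nc_torus
begin

lemma fields_add: "X \<in> torus_fields U \<Longrightarrow> Y \<in> torus_fields U \<Longrightarrow> X + Y \<in> torus_fields U"
  by (simp add: torus_fields_def smooth_add)

lemma fields_zero: "0 \<in> torus_fields U"
  by (simp add: torus_fields_def smooth_zero)

lemma fields_basis: "basis_field j \<in> torus_fields U"
  by (simp add: torus_fields_def axis_def smooth_zero smooth_one)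

lemma fields_smult: "a \<in> smooth_elements U \<Longrightarrow> X \<in> torus_fields U \<Longrightarrow> a *s X \<in> torus_fields U"
  by (simp add: torus_fields_def smooth_mult)

lemma fields_sum: "(\<And>j. j \<in> A \<Longrightarrow> X j \<in> torus_fields U) \<Longrightarrow> sum X A \<in> torus_fields U"
  by (induction A rule: infinite_finite_induct) (auto intro: fields_zero fields_add)

lemma fields_component: "X \<in> torus_fields U \<Longrightarrow> X $ j \<in> smooth_elements U"
  by (simp add: torus_fields_def)

lemma additive_on_fields_sum:
  fixes F :: "_ \<Rightarrow> 'b::ab_group_add"
  assumes add: "\<And>X Y. X \<in> torus_fields U \<Longrightarrow> Y \<in> torus_fields U \<Longrightarrow> F (X + Y) = F X + F Y"
    and X: "\<And>j. j \<in> A \<Longrightarrow> X j \<in> torus_fields U"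
  shows "F (sum X A) = (\<Sum>j\<in>A. F (X j))"
proof -
  have "F 0 = 0" using add[OF fields_zero fields_zero] by simp
  with X show ?thesis
    by (induction A rule: infinite_finite_induct) (simp_all add: add fields_sum)
qed

lemma metric_in_coordinates:
  assumes G: "torus_metric U G" and X: "X \<in> torus_fields U"
  shows "G X (basis_field k) = (\<Sum>j\<in>UNIV. X $ j * G (basis_field j) (basis_field k))"
proof -
  have "\<forall>X\<in>torus_fields U. \<forall>Y\<in>torus_fields U. \<forall>Z\<in>torus_fields U. G (X + Y) Z = G X Z + G Y Z"
    using G unfolding torus_metric_def by (elim conjE)
  hence add: "G (Y + Z) W = G Y W + G Z W"
    if "Y \<in> torus_fields U" "Z \<in> torus_fields U" "W \<in> torus_fields U" for Y Z W
    using that by blast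
  have "\<forall>a\<in>smooth_elements U. \<forall>X\<in>torus_fields U. \<forall>Y\<in>torus_fields U. G (a *s X) Y = a * G X Y"
    using G unfolding torus_metric_def by (elim conjE)
  hence smult: "G (a *s Y) W = a * G Y W"
    if "a \<in> smooth_elements U" "Y \<in> torus_fields U" "W \<in> torus_fields U" for a Y W
    using that by blast
  have "G (\<Sum>j\<in>UNIV. X $ j *s basis_field j) (basis_field k)
      = (\<Sum>j\<in>UNIV. G (X $ j *s basis_field j) (basis_field k))"
  proof (rule additive_on_fields_sum[of "\<lambda>X. G X (basis_field k)"])
    show "G (Y + Z) (basis_field k) = G Y (basis_field k) + G Z (basis_field k)"
      if "Y \<in> torus_fields U" "Z \<in> torus_fields U" for Y Z
      by (rule add[OF that fields_basis])
    show "X $ j *s basis_field j \<in> torus_fields U" for j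
      by (intro fields_smult fields_basis fields_component[OF X])
  qed
  also have "\<dots> = (\<Sum>j\<in>UNIV. X $ j * G (basis_field j) (basis_field k))"
    by (intro sum.cong refl smult fields_basis fields_component[OF X])
  finally show ?thesis by (simp add: sum_smult_axis vec_lambda_eta)
qed

lemma connection_in_coordinates:
  assumes D: "levi_civita U G D" and X: "X \<in> torus_fields U"
  shows "D i X $ k = torus_deriv U i (X $ k) + (\<Sum>j\<in>UNIV. X $ j * D i (basis_field j) $ k)"
proof -
  have "D i (\<Sum>j\<in>UNIV. X $ j *s basis_field j) = (\<Sum>j\<in>UNIV. D i (X $ j *s basis_field j))"
    by (rule additive_on_fields_sum)
       (use D X fields_basis in \<open>auto simp: levi_civita_def intro: fields_smult fields_component\<close>)
  also have "\<dots> = (\<Sum>j\<in>UNIV. torus_deriv U i (X $ j) *s basis_field j + X $ j *s D i (basis_field j))"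
    using D X fields_basis fields_component by (intro sum.cong) (auto simp: levi_civita_def)
  finally have "D i X = (\<chi> j. torus_deriv U i (X $ j)) + (\<Sum>j\<in>UNIV. X $ j *s D i (basis_field j))"
    by (simp add: sum.distrib sum_smult_axis vec_lambda_eta)
  thus ?thesis by simp
qed

end

section \<open>Curvature of a conformally flat metric\<close>

locale conformally_flat_torus = nc_torus \<Theta> U
  for \<Theta> :: "real^'n::{finite,linorder}^'n::{finite,linorder}" and U :: "'n \<Rightarrow> 'a::cstar_algebra" +
  fixes f :: 'a and G :: "'a^'n::{finite,linorder} \<Rightarrow> 'a^'n::{finite,linorder} \<Rightarrow> 'a"
    and D :: "'n \<Rightarrow> 'a^'n::{finite,linorder} \<Rightarrow> 'a^'n::{finite,linorder}"
  assumes f_smooth: "f \<in> smooth_elements U" and f_selfadjoint: "star f = f"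
    and metric: "torus_metric U G"
    and conformal: "G (basis_field i) (basis_field j) = (if i = j then exp f else 0)"
    and connection: "levi_civita U G D"
begin

text \<open>The noncommutative analogue of \<open>\<partial>\<^sub>i f\<close>, to which it reduces when \<open>f\<close> commutes with its derivatives.\<close>

definition logderiv :: "'n \<Rightarrow> 'a" where
  "logderiv i = torus_deriv U i (exp f) * exp (- f)"

lemma exp_f_inverse: "exp f * exp (- f) = 1" "exp (- f) * exp f = 1"
  using exp_minus_inverse[of f] exp_minus_inverse[of "- f"] by simp_all

lemma smooth_exps: "exp f \<in> smooth_elements U" "exp (- f) \<in> smooth_elements U"
  by (simp_all add: smooth_exp smooth_minus f_smooth)

lemma logderiv_smooth: "logderiv i \<in> smooth_elements U"
  unfolding logderiv_def by (intro smooth_mult smooth_deriv smooth_exps)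

lemma logderiv_mult_exp: "logderiv i * exp f = torus_deriv U i (exp f)"
  by (simp add: logderiv_def mult.assoc exp_f_inverse)

lemma metric_component: "X \<in> torus_fields U \<Longrightarrow> G X (basis_field k) = X $ k * exp f"
  by (simp add: metric_in_coordinates[OF metric] conformal if_distrib[of "\<lambda>x. _ * x"] cong: if_cong)

lemma fields_connection: "X \<in> torus_fields U \<Longrightarrow> D i X \<in> torus_fields U"
  using connection by (simp add: levi_civita_def)

text \<open>Pairing with \<open>\<partial>\<^sub>k\<close> multiplies the \<open>k\<close>-th component by \<open>exp f\<close> on the right, so the defining equation of the
  connection determines the components after right multiplication by \<open>exp (- f)\<close>.\<close>

lemma christoffel:
  "D i (basis_field j) $ k = (1/2) *\<^sub>R ((if j = k then logderiv i else 0) +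
      (if i = k then logderiv j else 0) - (if i = j then logderiv k else 0))"
proof -
  have gram: "gram_matrix G $ a $ b = (if a = b then exp f else 0)" for a b
    by (simp add: gram_matrix_def conformal)
  have deriv_if: "torus_deriv U a (if P then exp f else 0) = (if P then torus_deriv U a (exp f) else 0)" for a P
    by (simp add: deriv_zero)
  have "D i (basis_field j) $ k * exp f = G (D i (basis_field j)) (basis_field k)"
    by (simp add: metric_component fields_connection fields_basis)
  also have "\<dots> = (1/2) *\<^sub>R ((if j = k then torus_deriv U i (exp f) else 0) +
      (if i = k then torus_deriv U j (exp f) else 0) - (if i = j then torus_deriv U k (exp f) else 0))"
    using connection unfolding levi_civita_def gram deriv_if by blast
  finally have "D i (basis_field j) $ k * exp f * exp (- f) = \<dots> * exp (- f)" by simp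
  hence "D i (basis_field j) $ k = \<dots>"
    by (simp only: mult.assoc exp_f_inverse mult_1_right)
  also have "\<dots> = (1/2) *\<^sub>R ((if j = k then logderiv i else 0) +
      (if i = k then logderiv j else 0) - (if i = j then logderiv k else 0))"
    by (simp add: logderiv_def distrib_right left_diff_distrib)
  finally show ?thesis .
qed

text \<open>The products of Christoffel symbols contribute only squares of logarithmic derivatives: because of
  the Kronecker deltas, no product \<open>K\<^sub>i K\<^sub>k\<close> with \<open>i \<noteq> k\<close> occurs.\<close>

lemma sectional_component:
  assumes "i \<noteq> k"
  shows "curvature_op D i k (basis_field i) $ k =
     (1/4) *\<^sub>R (logderiv i * logderiv i + logderiv k * logderiv k - (\<Sum>j\<in>UNIV. logderiv j * logderiv j))
     - (1/2) *\<^sub>R (torus_deriv U i (logderiv i) + torus_deriv U k (logderiv k))"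
proof -
  let ?K = logderiv
  have 1: "D i (basis_field i) $ j = (if j = i then ?K i else 0) - (1/2) *\<^sub>R ?K j" for j
    by (simp add: christoffel scaleR_right_diff_distrib scaleR_add_right flip: scaleR_add_left)
  have 2: "D k (basis_field j) $ k = (1/2) *\<^sub>R ?K j" for j
    by (simp add: christoffel)
  have 3: "D k (basis_field i) $ j = (1/2) *\<^sub>R ((if j = i then ?K k else 0) + (if j = k then ?K i else 0))" for j
    using assms by (auto simp: christoffel)
  have 4: "D i (basis_field j) $ k = (1/2) *\<^sub>R ((if j = k then ?K i else 0) - (if j = i then ?K k else 0))" for j
    using assms by (auto simp: christoffel)
  have "(\<Sum>j\<in>UNIV. D i (basis_field i) $ j * D k (basis_field j) $ k)
      = (\<Sum>j\<in>UNIV. (1/2) *\<^sub>R (if j = i then ?K i * ?K i else 0) - (1/4) *\<^sub>R (?K j * ?K j))"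
    unfolding 1 2 by (rule sum.cong) (auto simp: algebra_simps)
  also have "\<dots> = (1/2) *\<^sub>R (?K i * ?K i) - (1/4) *\<^sub>R (\<Sum>j\<in>UNIV. ?K j * ?K j)"
    by (simp add: sum_subtractf scaleR_sum_right[symmetric])
  finally have s1: "(\<Sum>j\<in>UNIV. D i (basis_field i) $ j * D k (basis_field j) $ k) = \<dots>" .
  have "(\<Sum>j\<in>UNIV. D k (basis_field i) $ j * D i (basis_field j) $ k)
      = (\<Sum>j\<in>UNIV. (1/4) *\<^sub>R ((if j = k then ?K i * ?K i else 0) - (if j = i then ?K k * ?K k else 0)))"
    unfolding 3 4 using assms by (intro sum.cong) auto
  also have "\<dots> = (1/4) *\<^sub>R (?K i * ?K i - ?K k * ?K k)"
    by (simp only: scaleR_sum_right[symmetric] sum_subtractf) simp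
  finally have s2: "(\<Sum>j\<in>UNIV. D k (basis_field i) $ j * D i (basis_field j) $ k) = \<dots>" .
  have "curvature_op D i k (basis_field i) $ k
     = D k (D i (basis_field i)) $ k - D i (D k (basis_field i)) $ k"
    by (simp add: curvature_op_def)
  also have "\<dots> = (torus_deriv U k ((-1/2) *\<^sub>R ?K k) + ((1/2) *\<^sub>R (?K i * ?K i) - (1/4) *\<^sub>R (\<Sum>j\<in>UNIV. ?K j * ?K j)))
      - (torus_deriv U i ((1/2) *\<^sub>R ?K i) + (1/4) *\<^sub>R (?K i * ?K i - ?K k * ?K k))"
    unfolding connection_in_coordinates[OF connection fields_connection[OF fields_basis]] s1 s2
    unfolding 1 3 using assms by simp
  also have "\<dots> = (1/4) *\<^sub>R (?K i * ?K i + ?K k * ?K k - (\<Sum>j\<in>UNIV. ?K j * ?K j))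
     - (1/2) *\<^sub>R (torus_deriv U i (?K i) + torus_deriv U k (?K k))"
  proof -
    have half: "(1/2) *\<^sub>R x = (1/4) *\<^sub>R x + (1/4) *\<^sub>R x" for x :: 'a
      by (simp flip: scaleR_add_left)
    show ?thesis
      unfolding deriv_scaleR[OF logderiv_smooth]
      by (simp add: algebra_simps half[of "?K i * ?K i"])
  qed
  finally show ?thesis .
qed

text \<open>The formula of \<open>sectional_component\<close> makes sense for \<open>i = k\<close> too, where the curvature vanishes; so
  it is summed over all pairs and its diagonal values are subtracted.\<close>

lemma sectional_sum:
  "(\<Sum>i\<in>UNIV. \<Sum>k\<in>UNIV. curvature_op D i k (basis_field i) $ k) =
     - ((real CARD('n) - 1) *\<^sub>R (\<Sum>i\<in>UNIV. torus_deriv U i (logderiv i) +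
          ((real CARD('n) - 2) / 4) *\<^sub>R (logderiv i * logderiv i)))"
proof -
  define n where "n = real CARD('n)"
  define q where "q i = logderiv i * logderiv i" for i
  define t where "t i = torus_deriv U i (logderiv i)" for i
  define Q where "Q = (\<Sum>i\<in>UNIV. q i)"
  define T where "T = (\<Sum>i\<in>UNIV. t i)"
  define s where "s i k = (1/4) *\<^sub>R (q i + q k - Q) - (1/2) *\<^sub>R (t i + t k)" for i k
  have sec: "curvature_op D i k (basis_field i) $ k = s i k - (if k = i then s i i else 0)" for i k
    using sectional_component[of i k]
    by (cases "i = k") (auto simp: s_def q_def t_def Q_def curvature_op_def)
  have "(\<Sum>i\<in>UNIV. \<Sum>k\<in>UNIV. curvature_op D i k (basis_field i) $ k)
      = (\<Sum>i\<in>UNIV. \<Sum>k\<in>UNIV. s i k) - (\<Sum>i\<in>UNIV. s i i)"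
    by (simp add: sec sum_subtractf)
  also have "(\<Sum>i\<in>UNIV. \<Sum>k\<in>UNIV. s i k) = (1/4) *\<^sub>R (n *\<^sub>R Q + n *\<^sub>R Q - (n * n) *\<^sub>R Q) - (1/2) *\<^sub>R (n *\<^sub>R T + n *\<^sub>R T)"
    unfolding s_def
    by (simp add: sum_subtractf sum.distrib scaleR_sum_right[symmetric] Q_def[symmetric] T_def[symmetric] sum_constant_scaleR n_def del: sum_constant)
  also have "(\<Sum>i\<in>UNIV. s i i) = (1/4) *\<^sub>R (Q + Q - n *\<^sub>R Q) - (1/2) *\<^sub>R (T + T)"
    unfolding s_def
    by (simp add: sum_subtractf sum.distrib scaleR_sum_right[symmetric] Q_def[symmetric] T_def[symmetric] sum_constant_scaleR n_def del: sum_constant)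
  finally have "(\<Sum>i\<in>UNIV. \<Sum>k\<in>UNIV. curvature_op D i k (basis_field i) $ k) =
     (1/4) *\<^sub>R (n *\<^sub>R Q + n *\<^sub>R Q - (n * n) *\<^sub>R Q) - (1/2) *\<^sub>R (n *\<^sub>R T + n *\<^sub>R T)
      - ((1/4) *\<^sub>R (Q + Q - n *\<^sub>R Q) - (1/2) *\<^sub>R (T + T))" .
  also have "\<dots> = ((2 * n - n * n - (2 - n)) / 4) *\<^sub>R Q - (n - 1) *\<^sub>R T"
  proof -
    have lin: "(1/4) *\<^sub>R (a *\<^sub>R Q + b *\<^sub>R Q - c *\<^sub>R Q) - (1/2) *\<^sub>R (n *\<^sub>R T + n *\<^sub>R T)
       - ((1/4) *\<^sub>R (1 *\<^sub>R Q + 1 *\<^sub>R Q - n *\<^sub>R Q) - (1/2) *\<^sub>R (1 *\<^sub>R T + 1 *\<^sub>R T))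
      = ((a + b - c - (2 - n)) / 4) *\<^sub>R Q - (n - 1) *\<^sub>R T" for a b c
      unfolding scaleR_add_left[symmetric] scaleR_diff_left[symmetric] scaleR_scaleR
      by (simp add: diff_divide_distrib add_divide_distrib scaleR_add_left scaleR_diff_left algebra_simps)
    show ?thesis using lin[of n n "n * n"] by simp
  qed
  also have "(2 * n - n * n - (2 - n)) / 4 = - ((n - 1) * ((n - 2) / 4))" by (simp add: field_simps)
  also have "- ((n - 1) * ((n - 2) / 4)) *\<^sub>R Q - (n - 1) *\<^sub>R T = - ((n - 1) *\<^sub>R (T + ((n - 2) / 4) *\<^sub>R Q))"
    by (simp add: scaleR_add_right)
  finally show ?thesis
    by (simp add: Q_def T_def q_def t_def n_def sum.distrib scaleR_sum_right)
qed

lemma scalar_curvature_conformal: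
  "scalar_curvature G D = exp (- f) * exp (- f) *
     (\<Sum>i\<in>UNIV. \<Sum>k\<in>UNIV. curvature_op D i k (basis_field i) $ k) * exp f"
proof -
  have "gram_matrix G = (\<chi> i j. if i = j then exp f else 0)"
    by (simp add: gram_matrix_def conformal)
  hence inv: "matrix_inv (gram_matrix G) $ i $ j = (if i = j then exp (- f) else 0)" for i j
    by (simp add: matrix_inv_scalar[OF exp_f_inverse])
  have coeff: "curvature_coeff G D i k i k = curvature_op D i k (basis_field i) $ k * exp f" for i k
    unfolding curvature_coeff_def
  proof (rule metric_component)
    have "D a (D b X) \<in> torus_fields U" if "X \<in> torus_fields U" for a b X
      using that by (intro fields_connection)
    thus "curvature_op D i k (basis_field i) \<in> torus_fields U"
      using fields_basis by (simp add: curvature_op_def torus_fields_def smooth_diff)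
  qed
  have "scalar_curvature G D = (\<Sum>i\<in>UNIV. \<Sum>k\<in>UNIV. exp (- f) * exp (- f) * curvature_coeff G D i k i k)"
  proof -
    have "(\<Sum>k\<in>UNIV. \<Sum>l\<in>UNIV. (if i = j then exp (- f) else 0) * (if k = l then exp (- f) else 0)
            * curvature_coeff G D i k j l)
        = (if i = j then \<Sum>k\<in>UNIV. exp (- f) * exp (- f) * curvature_coeff G D i k i k else 0)" for i j
      by (simp add: if_distrib[of "\<lambda>x. x * _"] if_distrib[of "\<lambda>x. _ * x"] cong: if_cong)
    thus ?thesis unfolding scalar_curvature_def inv by simp
  qed
  also have "\<dots> = exp (- f) * exp (- f) * (\<Sum>i\<in>UNIV. \<Sum>k\<in>UNIV. curvature_op D i k (basis_field i) $ k) * exp f"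
    by (simp add: coeff sum_distrib_left sum_distrib_right mult.assoc)
  finally show ?thesis .
qed

text \<open>The curvature carries two factors \<open>exp (- f)\<close> on the left and one factor \<open>exp f\<close> on the right; with
  the weight there are three of the latter.  Moving the former around by the trace property leaves one.\<close>

lemma total_scalar_curvature:
  "torus_trace U (scalar_curvature G D * exp (2 *\<^sub>R f)) =
     torus_trace U ((\<Sum>i\<in>UNIV. \<Sum>k\<in>UNIV. curvature_op D i k (basis_field i) $ k) * exp f)"
proof -
  define S where "S = (\<Sum>i\<in>UNIV. \<Sum>k\<in>UNIV. curvature_op D i k (basis_field i) $ k)"
  have S: "S \<in> smooth_elements U"
    unfolding S_def sectional_sum
    by (intro smooth_minus smooth_scaleR smooth_sum smooth_add smooth_mult smooth_deriv logderiv_smooth)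
  have "exp (2 *\<^sub>R f) = exp f * exp f"
    by (simp add: scaleR_2 exp_add_commuting)
  hence "torus_trace U (scalar_curvature G D * exp (2 *\<^sub>R f))
      = torus_trace U (exp (- f) * exp (- f) * (S * exp f * exp f * exp f))"
    unfolding scalar_curvature_conformal S_def[symmetric] by (simp add: mult.assoc)
  also have "\<dots> = torus_trace U ((S * exp f * exp f * exp f) * (exp (- f) * exp (- f)))"
    by (intro trace_commute smooth_mult smooth_exps S)
  also have "(S * exp f * exp f * exp f) * (exp (- f) * exp (- f))
      = S * exp f * (exp f * (exp f * exp (- f)) * exp (- f))"
    by (simp only: mult.assoc)
  also have "\<dots> = S * exp f" by (simp add: exp_f_inverse)
  finally show ?thesis by (simp add: S_def)
qed

text \<open>The element whose modulus squared is the density of the total scalar curvature after integration by parts, up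
  to a constant; the Dirichlet energy density of \<open>exp (f/2)\<close> in the commutative case.\<close>

definition root_deriv :: "'n \<Rightarrow> 'a" where
  "root_deriv i = exp ((-1/2) *\<^sub>R f) * torus_deriv U i (exp f)"

lemma root_deriv_smooth: "root_deriv i \<in> smooth_elements U"
  unfolding root_deriv_def by (intro smooth_mult smooth_deriv smooth_exps smooth_exp smooth_scaleR f_smooth)

text \<open>The sign comes from \<open>(\<partial>\<^sub>i h)\<^sup>* = - \<partial>\<^sub>i (h\<^sup>*)\<close>: the derivations carry no factor \<open>i\<close>, so the derivative
  of a selfadjoint element is anti-selfadjoint.\<close>

lemma root_deriv_square:
  "logderiv i * logderiv i * exp f = - (star (root_deriv i) * root_deriv i)"
proof -
  let ?e = "exp ((-1/2) *\<^sub>R f)" and ?d = "torus_deriv U i (exp f)"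
  have "star (exp f) = exp f" by (simp add: star_exp f_selfadjoint)
  hence "?d = - star ?d" using deriv_star[OF smooth_exps(1), of i] by simp
  hence "star ?d = - ?d" by (metis minus_minus)
  moreover have "star ?e = ?e" by (simp add: star_exp star_scaleR star_minus f_selfadjoint)
  ultimately have "star (root_deriv i) = - ?d * ?e" by (simp add: root_deriv_def star_mult)
  moreover have "(-1/2) *\<^sub>R f + (-1/2) *\<^sub>R f = - f"
    by (simp only: scaleR_add_left[symmetric]) simp
  hence "?e * ?e = exp (- f)" by (metis exp_add_commuting)
  ultimately have "star (root_deriv i) * root_deriv i = - (?d * exp (- f) * ?d)"
    by (simp add: root_deriv_def mult.assoc[symmetric]) (simp add: mult.assoc)
  thus ?thesis by (simp add: mult.assoc logderiv_mult_exp) (simp add: logderiv_def mult.assoc)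
qed

text \<open>Integration by parts.\<close>

lemma trace_deriv_logderiv:
  "torus_trace U (torus_deriv U i (logderiv i) * exp f) = - torus_trace U (logderiv i * logderiv i * exp f)"
proof -
  have "torus_deriv U i (logderiv i * exp f) = torus_deriv U i (logderiv i) * exp f + logderiv i * logderiv i * exp f"
    using deriv_mult[OF logderiv_smooth smooth_exps(1), of i i] by (simp only: mult.assoc logderiv_mult_exp)
  hence "torus_trace U (torus_deriv U i (logderiv i) * exp f + logderiv i * logderiv i * exp f) = 0"
    using trace_deriv[of "logderiv i * exp f" i] by (simp add: smooth_mult logderiv_smooth smooth_exps)
  thus ?thesis
    by (simp add: trace_add smooth_mult smooth_deriv logderiv_smooth smooth_exps add_eq_0_iff)
qed

text \<open>With integration by parts the density \<open>\<partial>\<^sub>i K\<^sub>i + (n - 2)/4 K\<^sub>i\<^sup>2\<close> becomes \<open>((n - 2)/4 - 1) K\<^sub>i\<^sup>2\<close>, whence the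
  factor \<open>6 - n\<close>.  The prefactor is negative for \<open>1 < n < 6\<close>, in particular \<open>- 3/2\<close> for \<open>n = 4\<close>; only
  then, however, is \<open>exp (2 f)\<close> the square root of the determinant of the metric.\<close>

lemma total_scalar_curvature_energy:
  "torus_trace U (scalar_curvature G D * exp (2 *\<^sub>R f)) =
     - of_real ((real CARD('n) - 1) * (6 - real CARD('n)) / 4) *
        (\<Sum>i\<in>UNIV. torus_trace U (star (root_deriv i) * root_deriv i))"
proof -
  define n where "n = real CARD('n)"
  define t where "t i = torus_deriv U i (logderiv i) * exp f" for i
  define q where "q i = logderiv i * logderiv i * exp f" for i
  have sm: "t i \<in> smooth_elements U" "q i \<in> smooth_elements U" for i
    unfolding t_def q_def by (intro smooth_mult smooth_deriv logderiv_smooth smooth_exps)+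
  have "(\<Sum>i\<in>UNIV. \<Sum>k\<in>UNIV. curvature_op D i k (basis_field i) $ k) * exp f
      = (-(n - 1)) *\<^sub>R (\<Sum>i\<in>UNIV. t i + ((n - 2) / 4) *\<^sub>R q i)"
    unfolding sectional_sum scaleR_minus_left
    by (simp add: sum_distrib_right distrib_right t_def q_def n_def del: minus_diff_eq)
  hence "torus_trace U (scalar_curvature G D * exp (2 *\<^sub>R f))
      = of_real (-(n - 1)) * (\<Sum>i\<in>UNIV. torus_trace U (t i) + of_real ((n - 2) / 4) * torus_trace U (q i))"
    unfolding total_scalar_curvature
    by (simp only: trace_scaleR trace_sum trace_add smooth_sum smooth_add smooth_scaleR sm)
  also have "(\<Sum>i\<in>UNIV. torus_trace U (t i) + of_real ((n - 2) / 4) * torus_trace U (q i))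
      = of_real ((n - 6) / 4) * (\<Sum>i\<in>UNIV. torus_trace U (q i))"
    unfolding sum_distrib_left
    by (rule sum.cong) (simp_all add: t_def q_def trace_deriv_logderiv field_simps)
  also have "(\<Sum>i\<in>UNIV. torus_trace U (q i)) = - (\<Sum>i\<in>UNIV. torus_trace U (star (root_deriv i) * root_deriv i))"
    unfolding sum_negf[symmetric] q_def root_deriv_square
    using trace_scaleR[of "star (root_deriv i) * root_deriv i" "-1" for i]
    by (intro sum.cong) (simp_all add: smooth_mult smooth_star root_deriv_smooth)
  finally show ?thesis by (simp add: n_def field_simps)
qed

lemma exp_f_constant_if_root_deriv_zero:
  assumes "\<And>i. root_deriv i = 0"
  shows "\<exists>z. exp f = z *\<^sub>C 1"
proof (rule constant_if_deriv_zero[OF smooth_exps(1)])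
  fix i
  let ?e = "exp ((-1/2) *\<^sub>R f)"
  have "torus_deriv U i (exp f) = exp (- ((-1/2) *\<^sub>R f)) * ?e * torus_deriv U i (exp f)"
    using exp_minus_inverse[of "- ((-1/2) *\<^sub>R f)"] by simp
  also have "\<dots> = exp (- ((-1/2) *\<^sub>R f)) * root_deriv i"
    by (simp only: root_deriv_def mult.assoc)
  also have "\<dots> = 0" using assms by simp
  finally show "torus_deriv U i (exp f) = 0" .
qed

end

section \<open>Sign of the total scalar curvature in dimension four\<close>

theorem proposition3p1:
  fixes \<Theta> :: "real^4^4"
    and U :: "4 \<Rightarrow> 'a::cstar_algebra"
    and f :: 'a
    and G :: "'a^4 \<Rightarrow> 'a^4 \<Rightarrow> 'a"
    and D :: "4 \<Rightarrow> 'a^4 \<Rightarrow> 'a^4"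
  assumes "transpose \<Theta> = - \<Theta>"
    and "noncommutative_torus \<Theta> U"
    and "f \<in> smooth_elements U" and "star f = f"
    and "torus_metric U G"
    and "\<And>i j. G (basis_field i) (basis_field j) = (if i = j then exp f else 0)"
    and "levi_civita U G D"
  shows "torus_trace U (scalar_curvature G D * exp (2 *\<^sub>R f)) \<in> \<real>
       \<and> Re (torus_trace U (scalar_curvature G D * exp (2 *\<^sub>R f))) \<le> 0
       \<and> (torus_trace U (scalar_curvature G D * exp (2 *\<^sub>R f)) = 0
            \<longrightarrow> (\<exists>c. exp f = c *\<^sub>C 1))"
proof -
  interpret conformally_flat_torus \<Theta> U f G D
    by unfold_locales (use assms in auto)
  have "\<exists>r. torus_trace U (star (root_deriv i) * root_deriv i) = complex_of_real r \<and> r \<ge> 0 \<and> (r = 0 \<longrightarrow> root_deriv i = 0)" for i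
    using trace_star_mult_self[OF root_deriv_smooth[of i]] by metis
  then obtain r where r: "\<And>i. torus_trace U (star (root_deriv i) * root_deriv i) = complex_of_real (r i)"
    "\<And>i. r i \<ge> 0" "\<And>i. r i = 0 \<Longrightarrow> root_deriv i = 0"
    by metis
  define s where "s = (\<Sum>i\<in>UNIV. r i)"
  have eq: "torus_trace U (scalar_curvature G D * exp (2 *\<^sub>R f)) = complex_of_real (- (3/2) * s)"
    unfolding total_scalar_curvature_energy r s_def by simp
  have "\<exists>c. exp f = c *\<^sub>C 1" if "s = 0"
  proof (rule exp_f_constant_if_root_deriv_zero)
    fix i
    show "root_deriv i = 0"
      using that r(2,3) unfolding s_def by (subst (asm) sum_nonneg_eq_0_iff) auto
  qed
  moreover have "s \<ge> 0" unfolding s_def by (intro sum_nonneg r)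
  ultimately show ?thesis unfolding eq by auto
qed

end
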